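(* For any $i_1,\dots,i_k\in I$, $$\rho_\infty\big(\tilde f_{i_k}\cdots\tilde f_{i_1}T_\infty\big)=\tilde f_{n+1-i_k}\cdots\tilde f_{n+1-i_1}T_\infty,$$ and hence $\rho_\infty:\mathcal T(\infty)\to\mathcal T(\infty)$ is an involution.
   Context: Fix $n$, $I=\{1,\dots,n\}$. Marginally large tableaux. A semistandard Young tableau with $n$ nonempty rows and entries in $\{1,\dots,n+1\}$ is marginally large if for every $i\in I$ the number of $i$-boxes (boxes with entry $i$) in row $i$ exceeds the total number of boxes in row $i+1$ by exactly one (row $n+1$ is empty). An MLT is the infinite tableau obtained from such a tableau by adding, for every $i\in I$, infinitely many $i$-boxes at the left end of row $i$. For an MLT $T$ and $1\le j<i\le n+1$, $y_j^i(T)$ is the number of $i$-boxes in row $j$; $T$ is determined by these nonnegative integers. $\mathcal T(\infty)$ is the set of MLTs and $T_\infty$ the MLT with all $y_j^i=0$. Operators on $\mathcal T(\infty)$: read the boxes of $T$ by columns from right to left, each column from top to bottom; write $+$ for each entry $i$ and $-$ for each entry $i+1$; cancel successively all pairs $(+,-)$ ($+$ before $-$). The remaining sequence of $-$'s followed by $+$'s is the $i$-signature. $\tilde f_iT$ is obtained by changing $i$ to $i+1$ in the box of the leftmost $+$ and, if the result is not marginally large, pushing all rows below the changed box to the left by one box. Every element of $\mathcal T(\infty)$ has the form $\tilde f_{i_k}\cdots\tilde f_{i_1}T_\infty$ ($\mathcal T(\infty)$ realizes the crystal $\mathcal B(\infty)$ of type $A_n$, with $T_\infty$ corresponding to $u_\infty$).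 $\mathcal T'(\infty)$ is the set of tableaux obtained from MLTs by replacing every entry $a$ by $n+2-a$, and $\eta:\mathcal T'(\infty)\to\mathcal T(\infty)$ is the bijection replacing every entry $a$ by $n+2-a$. On $\mathcal T'(\infty)$ put $\tilde f_i'T=\eta^{-1}(\tilde f_{n+1-i}\eta(T))$. The map $\rho_\infty:\mathcal T(\infty)\to\mathcal T(\infty)$ is defined by: for $X=\tilde f_{i_k}\cdots\tilde f_{i_1}T_\infty$, $\rho_\infty(X)=\eta\big(\tilde f_{i_k}'\cdots\tilde f_{i_1}'\,\eta^{-1}(T_\infty)\big)$; it is well defined (independent of the chosen word). *)

theory Defs
  imports Main
begin

section \<open>Finite tableaux\<close>

text \<open>
  A finite tableau is the list of its rows from top to bottom; rows are numbered from 1,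
  and all rows below the last one are empty.
\<close>

definition row :: "nat list list \<Rightarrow> nat \<Rightarrow> nat list" where
  "row t i = (if 1 \<le> i \<and> i \<le> length t then t ! (i - 1) else [])"

definition semistandard :: "nat \<Rightarrow> nat list list \<Rightarrow> bool" where
  "semistandard n t \<longleftrightarrow>
     length t = n \<and>
     (\<forall>r\<in>set t. r \<noteq> [] \<and> sorted r \<and> set r \<subseteq> {1..n + 1}) \<and>
     (\<forall>i\<in>{1..<n}. length (row t (i + 1)) \<le> length (row t i) \<and>
        (\<forall>k<length (row t (i + 1)). row t i ! k < row t (i + 1) ! k))"

definition marginally_large :: "nat \<Rightarrow> nat list list \<Rightarrow> bool" where
  "marginally_large n t \<longleftrightarrow>
     semistandard n t \<and>
     (\<forall>i\<in>{1..n}. count_list (row t i) i = length (row t (i + 1)) + 1)"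


section \<open>Infinite tableaux\<close>

text \<open>
  The rows of the infinite tableaux extend to the left without end. A box is addressed by a pair
  \<open>(j, c)\<close>: its row \<open>j \<ge> 1\<close>, and the distance \<open>c\<close> of its column from the column containing the
  right end of row 1, so that \<open>c\<close> grows from right to left. \<open>None\<close> means that there is no box.
  Row 1 is never pushed by the operators below, so this fixes the horizontal position of a
  tableau once and for all.
\<close>

type_synonym box = "nat \<times> nat"
type_synonym tableau = "box \<Rightarrow> nat option"

text \<open>
  Column \<open>c\<close> is the column number \<open>length (row t 1) - c\<close>, counted from the left and starting with 1,
  of the finite tableau \<open>t\<close>. For \<open>c \<ge> length (row t 1)\<close> it is one of the infinitely many columns
  added on the left.
\<close>

definition mlt_of :: "nat \<Rightarrow> nat list list \<Rightarrow> tableau" where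
  "mlt_of n t = (\<lambda>(i, c).
     if i \<in> {1..n} \<and> length (row t 1) - c \<le> length (row t i)
     then Some (if c < length (row t 1) then row t i ! (length (row t 1) - c - 1) else i)
     else None)"

definition MLT :: "nat \<Rightarrow> tableau set" where
  "MLT n = mlt_of n ` {t. marginally_large n t}"

text \<open>
  Only used for \<open>j < i\<close>; row \<open>j\<close> of an MLT contains infinitely many \<open>j\<close>-boxes, but only finitely
  many others.
\<close>

definition num_boxes :: "tableau \<Rightarrow> nat \<Rightarrow> nat \<Rightarrow> nat" where
  "num_boxes T j i = card {c. T (j, c) = Some i}"

definition T_inf :: "nat \<Rightarrow> tableau" where
  "T_inf n = (THE T. T \<in> MLT n \<and> (\<forall>j i. 1 \<le> j \<and> j < i \<and> i \<le> n + 1 \<longrightarrow> num_boxes T j i = 0))"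


section \<open>Signatures and Kashiwara operators\<close>

text \<open>Columns from right to left, each column from top to bottom.\<close>

definition read_before :: "box \<Rightarrow> box \<Rightarrow> bool" (infix "\<prec>" 50) where
  "p \<prec> q \<longleftrightarrow> snd p < snd q \<or> snd p = snd q \<and> fst p < fst q"

text \<open>
  Boxes with entry \<open>i\<close> carry a plus, boxes with entry \<open>i + 1\<close> carry a minus, all others nothing.
  A plus and a later minus cancel as soon as everything between them has cancelled. The pairs
  are defined inductively since the sequence of signs may be infinite.
\<close>

inductive cancelled_pair :: "tableau \<Rightarrow> nat \<Rightarrow> box \<Rightarrow> box \<Rightarrow> bool" for T i where
  "\<lbrakk>T p = Some i; T q = Some (i + 1); p \<prec> q;
    \<forall>r. p \<prec> r \<and> r \<prec> q \<and> T r \<in> {Some i, Some (i + 1)} \<longrightarrow>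
      (\<exists>s. p \<prec> s \<and> s \<prec> q \<and> (cancelled_pair T i r s \<or> cancelled_pair T i s r))\<rbrakk>
   \<Longrightarrow> cancelled_pair T i p q"

definition signature_plus :: "tableau \<Rightarrow> nat \<Rightarrow> box \<Rightarrow> bool" where
  "signature_plus T i p \<longleftrightarrow> T p = Some i \<and> (\<nexists>q. cancelled_pair T i p q)"

definition leftmost_plus :: "tableau \<Rightarrow> nat \<Rightarrow> box" where
  "leftmost_plus T i =
     (THE p. signature_plus T i p \<and> (\<forall>q. signature_plus T i q \<and> q \<noteq> p \<longrightarrow> p \<prec> q))"

definition push_below :: "nat \<Rightarrow> tableau \<Rightarrow> tableau" where
  "push_below j T = (\<lambda>(k, c).
     if j < k then (if c = 0 then None else T (k, c - 1)) else T (k, c))"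

definition f_op :: "nat \<Rightarrow> nat \<Rightarrow> tableau \<Rightarrow> tableau" where
  "f_op n i T =
     (let b = leftmost_plus T i; T' = T(b \<mapsto> i + 1)
      in if T' \<in> MLT n then T' else push_below (fst b) T')"


section \<open>Tableaux with reversed entries and the map \<open>\<rho>\<^sub>\<infinity>\<close>\<close>

definition reverse_entries :: "nat \<Rightarrow> tableau \<Rightarrow> tableau" where
  "reverse_entries n T = (\<lambda>b. map_option (\<lambda>a. n + 2 - a) (T b))"

definition MLT' :: "nat \<Rightarrow> tableau set" where
  "MLT' n = reverse_entries n ` MLT n"

definition eta :: "nat \<Rightarrow> tableau \<Rightarrow> tableau" where
  "eta n T = reverse_entries n T"

definition eta_inv :: "nat \<Rightarrow> tableau \<Rightarrow> tableau" where
  "eta_inv n = inv_into (MLT' n) (eta n)"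

definition f_op' :: "nat \<Rightarrow> nat \<Rightarrow> tableau \<Rightarrow> tableau" where
  "f_op' n i T = eta_inv n (f_op n (n + 1 - i) (eta n T))"

text \<open>
  The word \<open>[i\<^sub>1, \<dots>, i\<^sub>k]\<close> acts by applying the operator of \<open>i\<^sub>1\<close> first. The description of
  \<open>rho n X\<close> is meaningful because every MLT is reached by some word, and the result does not
  depend on the word.
\<close>

definition rho :: "nat \<Rightarrow> tableau \<Rightarrow> tableau" where
  "rho n X = (THE Z. \<exists>w. set w \<subseteq> {1..n} \<and> X = fold (f_op n) w (T_inf n) \<and>
                Z = eta n (fold (f_op' n) w (eta_inv n (T_inf n))))"

end

theory Submission
  imports Defs
begin

text \<open>
  The statement contains the claim that \<open>i \<mapsto> n + 1 - i\<close> is compatible with all relations between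
  words: if two words produce the same MLT from \<open>T_inf n\<close>, so do the words with complemented
  letters. Everything else follows from this, from the fact that every MLT is reached by a word,
  and from \<open>n + 1 - (n + 1 - i) = i\<close>. In crystal language, the Dynkin diagram automorphism lifts
  to \<open>B(\<infinity>)\<close>; the proof below is combinatorial.

  An MLT is recorded by the multisegment \<open>m\<close> in which \<open>m a b\<close>, the multiplicity of the segment
  \<open>[a, b]\<close>, is the number of \<open>(b + 1)\<close>-boxes in row \<open>a\<close>. The Kashiwara operator \<open>f_end i\<close> changes
  the right end of a segment: it turns some \<open>[a, i - 1]\<close> into \<open>[a, i]\<close>, or adds \<open>[i, i]\<close>. The row
  \<open>a\<close> is the last maximum of a height function, because the signature is a bracketing problem and
  its leftmost uncancelled plus sits at the last minimum of the partial sums of signs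
  (\<open>leftmost_plus_last_minimum\<close>, \<open>f_op_tableau_of\<close>). Reflecting all segments at the midpoint of
  \<open>[1, n]\<close> turns \<open>f_end (n + 1 - i)\<close> into an operator \<open>f_start n i\<close> that changes left ends.
  Hence the claim about words says that \<open>f_end\<close> and \<open>f_start\<close> satisfy the same relations when
  applied to the empty multisegment.

  This is proved with the relation \<open>dual\<close>, generated by the empty pair and closed under applying
  \<open>f_end i\<close> on one side and \<open>f_start n i\<close> on the other, in both orders. It has to be shown that
  \<open>dual\<close> is a partial function (\<open>dual_unique\<close>). The operators of one family obey complicated
  relations among themselves, of degree up to four, but an operator of one family and one of the
  other meet in at most four multiplicities. So they commute when their indices differ
  (\<open>f_end_f_start_commute\<close>). For equal indices there is a number \<open>slack \<ge> 0\<close>: at \<open>0\<close> both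
  operators agree, from \<open>2\<close> on they commute. By induction on the total length, if \<open>m\<close> arises both
  as \<open>f_end i p\<close> and as \<open>f_start n k q\<close>, then both presentations give the same partner of \<open>m\<close>:
  either \<open>p = q\<close>, or the two steps complete to a commuting square. Two presentations of \<open>m\<close> of the
  same kind are compared through a third one of the other kind, which always exists; hence the
  relations within one family never have to be looked at.
\<close>

section \<open>Multisegments and the operators that lengthen segments at the right end\<close>

text \<open>
  Multiplicities are integers, so that the changes made by the operators are additive and commute
  as such; nonnegativity is part of membership in \<open>multisegments n\<close>.
\<close>

type_synonym multisegment = "nat \<Rightarrow> nat \<Rightarrow> int"

definition multisegments :: "nat \<Rightarrow> multisegment set" where
  "multisegments n = {m. \<forall>a b. 0 \<le> m a b \<and> (m a b \<noteq> 0 \<longrightarrow> 1 \<le> a \<and> a \<le> b \<and> b \<le> n)}"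

text \<open>
  The \<open>i\<close>-signature reads rows \<open>1, 2, \<dots>\<close> in turn, and in row \<open>c\<close> first \<open>m c i\<close> minus signs and then
  \<open>m c (i - 1)\<close> plus signs. The height is the surplus of minus signs over plus signs just after the
  minus signs of row \<open>a\<close>.
\<close>

definition height :: "multisegment \<Rightarrow> nat \<Rightarrow> nat \<Rightarrow> int" where
  "height m i a = (\<Sum>c = 1..a. m c i) - (\<Sum>c = 1..<a. m c (i - 1))"

text \<open>
  Some plus in row \<open>a\<close> survives the cancellation iff the height stays below \<open>height m i a\<close> in all later
  rows. The first row with this property is the last maximum.
\<close>

definition end_row :: "multisegment \<Rightarrow> nat \<Rightarrow> nat" where
  "end_row m i = (GREATEST a. a \<in> {1..i} \<and> (\<forall>c\<in>{1..i}. height m i c \<le> height m i a))"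

definition lengthen_end :: "nat \<Rightarrow> nat \<Rightarrow> multisegment \<Rightarrow> multisegment" where
  "lengthen_end a i m = (\<lambda>x y. m x y + (if x = a \<and> y = i then 1 else 0)
     - (if x = a \<and> y = i - 1 \<and> a < i then 1 else 0))"

definition f_end :: "nat \<Rightarrow> multisegment \<Rightarrow> multisegment" where
  "f_end i m = lengthen_end (end_row m i) i m"

text \<open>
  The number of surviving minus signs, known as \<open>\<epsilon>\<^sub>i\<close> in crystal theory.
\<close>

definition eps_end :: "nat \<Rightarrow> multisegment \<Rightarrow> int" where
  "eps_end i m = height m i (end_row m i)"

lemma height_Suc:
  "1 \<le> a \<Longrightarrow> height m i (Suc a) = height m i a + m (Suc a) i - m a (i - 1)"
  by (simp add: height_def)

lemma end_row_props:
  assumes "1 \<le> i"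
  shows "end_row m i \<in> {1..i}"
    and "\<And>c. c \<in> {1..i} \<Longrightarrow> height m i c \<le> height m i (end_row m i)"
    and "\<And>c. c \<in> {1..i} \<Longrightarrow> end_row m i < c \<Longrightarrow> height m i c < height m i (end_row m i)"
proof -
  let ?P = "\<lambda>a. a \<in> {1..i} \<and> (\<forall>c\<in>{1..i}. height m i c \<le> height m i a)"
  have ne: "height m i ` {1..i} \<noteq> {}" "finite (height m i ` {1..i})" using assms by auto
  then have "Max (height m i ` {1..i}) \<in> height m i ` {1..i}" by (rule Max_in[rotated])
  then obtain a where a: "a \<in> {1..i}" "height m i a = Max (height m i ` {1..i})" by auto
  then have Pa: "?P a" using ne by auto
  have P: "?P (end_row m i)" unfolding end_row_def
    by (rule GreatestI_nat[where P = ?P and b = i]) (use Pa in auto)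
  then show "end_row m i \<in> {1..i}" and le: "\<And>c. c \<in> {1..i} \<Longrightarrow> height m i c \<le> height m i (end_row m i)"
    by auto
  fix c assume c: "c \<in> {1..i}" "end_row m i < c"
  show "height m i c < height m i (end_row m i)"
  proof (rule ccontr)
    assume "\<not> ?thesis"
    then have "?P c" using P c by force
    then have "c \<le> end_row m i" unfolding end_row_def
      by (rule Greatest_le_nat[where P = ?P and b = i]) auto
    then show False using c by simp
  qed
qed

lemma end_row_eqI:
  assumes "a \<in> {1..i}" "\<And>c. c \<in> {1..i} \<Longrightarrow> height m i c \<le> height m i a"
    and "\<And>c. c \<in> {1..i} \<Longrightarrow> a < c \<Longrightarrow> height m i c < height m i a"
  shows "end_row m i = a"
proof -
  have "1 \<le> i" using assms(1) by simp
  note p = end_row_props[OF this, where m = m]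
  show ?thesis
    using p(1) p(2)[OF assms(1)] p(3)[OF assms(1)] assms(2)[OF p(1)] assms(3)[OF p(1)]
    by (meson linorder_neqE_nat not_le)
qed

lemma height_lengthen_end:
  assumes "a \<in> {1..i}" "c \<in> {1..i}"
  shows "height (lengthen_end a i m) i c = height m i c + (if c < a then 0 else if c = a then 1 else 2)"
proof -
  have 1: "(\<Sum>k = 1..c. lengthen_end a i m k i) = (\<Sum>k = 1..c. m k i) + (if a \<le> c then 1 else 0)"
  proof -
    have "i \<noteq> i - 1" using assms by auto
    then show ?thesis using assms by (auto simp: lengthen_end_def sum.distrib sum_subtractf)
  qed
  have "(\<Sum>k = 1..<c. lengthen_end a i m k (i - 1))
      = (\<Sum>k = 1..<c. m k (i - 1) + (if k = a then - 1 else 0))"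
    using assms by (intro sum.cong) (auto simp: lengthen_end_def)
  also have "\<dots> = (\<Sum>k = 1..<c. m k (i - 1)) + (if a < c then -1 else 0)"
    using assms by (subst sum.distrib) (auto simp: sum.delta)
  finally show ?thesis using 1 by (auto simp: height_def)
qed

text \<open>
  Beyond the changed row both a minus is gained and a plus is lost, whence the \<open>2\<close>. It is this jump
  that makes the changed row recognisable afterwards: from the last maximum it becomes the first.
\<close>

lemma height_f_end:
  assumes "c \<in> {1..i}"
  shows "height (f_end i m) i c = height m i c
    + (if c < end_row m i then 0 else if c = end_row m i then 1 else 2)"
  unfolding f_end_def by (rule height_lengthen_end) (use assms end_row_props(1)[of i m] in auto)

lemma eps_end_eqI:
  assumes "a \<in> {1..i}" "\<And>c. c \<in> {1..i} \<Longrightarrow> height m i c \<le> e" "height m i a = e"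
  shows "eps_end i m = e"
proof -
  have i: "1 \<le> i" using assms(1) by simp
  show ?thesis
    using end_row_props(2)[OF i assms(1), of m] assms(2)[OF end_row_props(1)[OF i, of m]] assms(3)
    by (simp add: eps_end_def)
qed

lemma eps_end_f_end:
  assumes "1 \<le> i"
  shows "eps_end i (f_end i m) = eps_end i m + 1"
proof (rule eps_end_eqI[of "end_row m i"])
  show "end_row m i \<in> {1..i}" using end_row_props(1)[OF assms] .
  then show "height (f_end i m) i (end_row m i) = eps_end i m + 1"
    by (simp add: height_f_end eps_end_def)
  show "height (f_end i m) i c \<le> eps_end i m + 1" if "c \<in> {1..i}" for c
    using end_row_props(2,3)[OF assms that, of m]
    unfolding height_f_end[OF that] eps_end_def by (auto split: if_splits)
qed

text \<open>
  The changed row is the first maximum of the new height, so it can be read off from the result.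
\<close>

lemma f_end_inj:
  assumes i: "1 \<le> i" and eq: "f_end i m = f_end i m'"
  shows "m = m'"
proof -
  have *: "height (f_end i k) i c < height (f_end i k) i (end_row k i)"
     if "c \<in> {1..i}" "c < end_row k i" for c and k :: multisegment
    using end_row_props[OF i, where m=k] that by (force simp: height_f_end)
  have **: "height (f_end i k) i c \<le> height (f_end i k) i (end_row k i)"
     if "c \<in> {1..i}" for c and k :: multisegment
    using end_row_props[OF i, where m=k] that by (force simp: height_f_end)
  have "end_row m i = end_row m' i"
    using *[of "end_row m i" m'] *[of "end_row m' i" m] **[of "end_row m i" m'] **[of "end_row m' i" m]
      end_row_props(1)[OF i] eq by (metis linorder_neqE_nat not_le)
  then have "lengthen_end (end_row m i) i m x y = lengthen_end (end_row m i) i m' x y" for x y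
    using eq by (simp add: f_end_def)
  then show ?thesis by (auto simp: lengthen_end_def fun_eq_iff)
qed

text \<open>
  At the last maximum the height drops in the next row, which requires a plus in the row itself.
\<close>

lemma multisegments_f_end:
  assumes m: "m \<in> multisegments n" and i: "i \<in> {1..n}"
  shows "f_end i m \<in> multisegments n"
    and "end_row m i < i \<Longrightarrow> 0 < m (end_row m i) (i - 1)"
proof -
  let ?a = "end_row m i"
  have a: "?a \<in> {1..i}" using end_row_props(1) i by simp
  show pos: "0 < m ?a (i - 1)" if "?a < i"
  proof -
    have "height m i (Suc ?a) < height m i ?a" using that i by (intro end_row_props) auto
    moreover have "height m i (Suc ?a) = height m i ?a + m (Suc ?a) i - m ?a (i - 1)"
      using a by (intro height_Suc) simp
    moreover have "0 \<le> m (Suc ?a) i" using m by (simp add: multisegments_def)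
    ultimately show ?thesis by simp
  qed
  show "f_end i m \<in> multisegments n"
    using m a i pos unfolding multisegments_def f_end_def lengthen_end_def
    by (auto; force)
qed

text \<open>
  Undoing the change at the first maximum of the height turns this maximum into the last one.
  Positivity of the maximum is needed in row 1, where it guarantees that there is a minus to undo.
\<close>

lemma f_end_preimage:
  assumes m: "m \<in> multisegments n" and i: "i \<in> {1..n}" and pos: "0 < eps_end i m"
  shows "\<exists>k\<in>multisegments n. f_end i k = m"
proof -
  have i1: "1 \<le> i" using i by simp
  let ?P = "\<lambda>a. a \<in> {1..i} \<and> height m i a = eps_end i m"
  have le: "height m i c \<le> eps_end i m" if "c \<in> {1..i}" for c
    using end_row_props(2)[OF i1 that] by (simp add: eps_end_def)
  have ex: "?P (end_row m i)" using end_row_props(1)[OF i1] by (simp add: eps_end_def)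
  define a where "a = (LEAST a. ?P a)"
  have a: "a \<in> {1..i}" "height m i a = eps_end i m" using LeastI[of ?P, OF ex] by (auto simp: a_def)
  have lt: "height m i c < eps_end i m" if "c \<in> {1..i}" "c < a" for c
    using not_less_Least[of c ?P] that le[OF that(1)] by (auto simp: a_def)
  define k where "k = (\<lambda>x y. m x y - (if x = a \<and> y = i then 1 else 0)
     + (if x = a \<and> y = i - 1 \<and> a < i then 1 else 0))"
  have mk: "m = lengthen_end a i k" by (auto simp: k_def lengthen_end_def fun_eq_iff)
  have hk: "height m i c = height k i c + (if c < a then 0 else if c = a then 1 else 2)"
    if "c \<in> {1..i}" for c
    unfolding mk using height_lengthen_end[OF a(1) that] .
  have "end_row k i = a"
  proof (rule end_row_eqI[OF a(1)])
    fix c assume c: "c \<in> {1..i}"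
    show "height k i c \<le> height k i a" using hk[OF c] hk[OF a(1)] a(2) le[OF c] lt[OF c]
      by (auto split: if_splits)
    show "height k i c < height k i a" if "a < c" using hk[OF c] hk[OF a(1)] a(2) le[OF c] that
      by (auto split: if_splits)
  qed
  then have fk: "f_end i k = m" by (simp add: f_end_def mk[symmetric])
  have "0 < m a i"
  proof (cases "a = 1")
    case True
    then show ?thesis using a(2) pos by (simp add: height_def)
  next
    case False
    then have b: "a - 1 \<in> {1..i}" "Suc (a - 1) = a" "a - 1 < a" using a(1) by (auto simp: Suc_le_eq)
    have "height m i (Suc (a - 1)) = height m i (a - 1) + m (Suc (a - 1)) i - m (a - 1) (i - 1)"
      using b(1) by (intro height_Suc) simp
    moreover have "0 \<le> m (a - 1) (i - 1)" using m by (simp add: multisegments_def)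
    ultimately show ?thesis using lt[OF b(1,3)] a(2) b(2) by simp
  qed
  then have "k \<in> multisegments n"
    using m a(1) i unfolding multisegments_def k_def by (auto; force)
  then show ?thesis using fk by blast
qed

lemma eps_end_nonneg:
  assumes "m \<in> multisegments n" "1 \<le> i"
  shows "0 \<le> eps_end i m"
proof -
  have "height m i 1 \<le> eps_end i m" using assms end_row_props(2)[of i 1 m] by (auto simp: eps_end_def)
  moreover have "0 \<le> height m i 1" using assms by (simp add: height_def multisegments_def)
  ultimately show ?thesis by simp
qed

text \<open>
  In the first row that carries any segment, the height counts minus signs only.
\<close>

lemma eps_end_pos_ex:
  assumes m: "m \<in> multisegments n" and "m \<noteq> (\<lambda>_ _. 0)"
  shows "\<exists>i\<in>{1..n}. 0 < eps_end i m"
proof -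
  obtain a b where "m a b \<noteq> 0" using assms(2) by (auto simp: fun_eq_iff)
  then have ex: "\<exists>a. \<exists>b. m a b \<noteq> 0" by blast
  define a where "a = (LEAST a. \<exists>b. m a b \<noteq> 0)"
  obtain b where b: "m a b \<noteq> 0" using LeastI_ex[OF ex] by (auto simp: a_def)
  have z: "m c d = 0" if "c < a" for c d using not_less_Least[of c "\<lambda>a. \<exists>b. m a b \<noteq> 0"] that
    by (auto simp: a_def)
  have r: "0 < m a b" "1 \<le> a" "a \<le> b" "b \<le> n" using m b by (auto simp: multisegments_def order_less_le)
  have "height m b a = m a b + (\<Sum>c = 1..<a. m c b) - (\<Sum>c = 1..<a. m c (b - 1))"
  proof -
    have "{1..a} = insert a {1..<a}" using r by auto
    then show ?thesis by (simp add: height_def)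
  qed
  then have "height m b a = m a b" using z by simp
  then have "0 < eps_end b m" using end_row_props(2)[of b a m] r by (simp add: eps_end_def)
  then show ?thesis using r by auto
qed

section \<open>The operators that lengthen segments at the left end\<close>

definition flip :: "nat \<Rightarrow> multisegment \<Rightarrow> multisegment" where
  "flip n m = (\<lambda>a b. m (n + 1 - b) (n + 1 - a))"

definition f_start :: "nat \<Rightarrow> nat \<Rightarrow> multisegment \<Rightarrow> multisegment" where
  "f_start n j m = flip n (f_end (n + 1 - j) (flip n m))"

definition eps_start :: "nat \<Rightarrow> nat \<Rightarrow> multisegment \<Rightarrow> int" where
  "eps_start n j m = eps_end (n + 1 - j) (flip n m)"

text \<open>
  The height function for left ends, as a function of the common right end \<open>b\<close> of the segments. The
  direction is reversed by \<open>flip\<close>, so \<open>f_start\<close> acts at the first maximum of \<open>co_height\<close>.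
\<close>

definition co_height :: "nat \<Rightarrow> multisegment \<Rightarrow> nat \<Rightarrow> nat \<Rightarrow> int" where
  "co_height n m j b = height (flip n m) (n + 1 - j) (n + 1 - b)"

definition start_col :: "nat \<Rightarrow> multisegment \<Rightarrow> nat \<Rightarrow> nat" where
  "start_col n m j = n + 1 - end_row (flip n m) (n + 1 - j)"

definition lengthen_start :: "nat \<Rightarrow> nat \<Rightarrow> multisegment \<Rightarrow> multisegment" where
  "lengthen_start j b m = (\<lambda>x y. m x y + (if x = j \<and> y = b then 1 else 0)
     - (if x = j + 1 \<and> y = b \<and> j < b then 1 else 0))"

lemma flip_multisegments:
  assumes "m \<in> multisegments n"
  shows "flip n m \<in> multisegments n"
proof -
  have "0 \<le> m (n + 1 - b) (n + 1 - a)"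
    and "m (n + 1 - b) (n + 1 - a) \<noteq> 0 \<longrightarrow> 1 \<le> n + 1 - b \<and> n + 1 - b \<le> n + 1 - a \<and> n + 1 - a \<le> n" for a b
    using assms unfolding multisegments_def by blast+
  moreover have "1 \<le> a \<and> a \<le> b \<and> b \<le> n"
    if "1 \<le> n + 1 - b \<and> n + 1 - b \<le> n + 1 - a \<and> n + 1 - a \<le> n" for a b
    using that by arith
  ultimately show ?thesis unfolding multisegments_def flip_def by blast
qed

lemma flip_flip:
  assumes "m \<in> multisegments n"
  shows "flip n (flip n m) = m"
proof (intro ext)
  fix a b
  have z: "m a b = 0" if "\<not> (1 \<le> a \<and> a \<le> b \<and> b \<le> n)" for a b
    using assms that by (auto simp: multisegments_def)
  have "m (n + 1 - (n + 1 - a)) (n + 1 - (n + 1 - b)) = m a b"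
  proof (cases "a \<le> n + 1 \<and> b \<le> n + 1")
    case False
    then have "m a b = 0" by (intro z) auto
    moreover have "m (n + 1 - (n + 1 - a)) (n + 1 - (n + 1 - b)) = 0" using False by (intro z) auto
    ultimately show ?thesis by simp
  qed auto
  then show "flip n (flip n m) a b = m a b" by (simp add: flip_def)
qed

lemma f_start_multisegments:
  assumes "m \<in> multisegments n" "j \<in> {1..n}"
  shows "f_start n j m \<in> multisegments n"
  unfolding f_start_def using assms by (intro flip_multisegments multisegments_f_end(1)) auto

lemma co_height_eq:
  assumes "j \<in> {1..n}" "b \<in> {j..n}"
  shows "co_height n m j b = (\<Sum>d = b..n. m j d) - (\<Sum>d = Suc b..n. m (Suc j) d)"
proof -
  have "(\<Sum>c = 1..n + 1 - b. flip n m c (n + 1 - j)) = (\<Sum>d = b..n. m j d)"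
    by (rule sum.reindex_bij_witness[where i = "\<lambda>d. n + 1 - d" and j = "\<lambda>c. n + 1 - c"])
       (use assms in \<open>auto simp: flip_def\<close>)
  moreover have "(\<Sum>c = 1..<n + 1 - b. flip n m c (n + 1 - j - 1)) = (\<Sum>d = Suc b..n. m (Suc j) d)"
    by (rule sum.reindex_bij_witness[where i = "\<lambda>d. n + 1 - d" and j = "\<lambda>c. n + 1 - c"])
       (use assms in \<open>auto simp: flip_def Suc_diff_le\<close>)
  ultimately show ?thesis by (simp add: co_height_def height_def)
qed

lemma start_col_props:
  assumes "j \<in> {1..n}"
  shows "start_col n m j \<in> {j..n}"
    and "\<And>d. d \<in> {j..n} \<Longrightarrow> co_height n m j d \<le> co_height n m j (start_col n m j)"
    and "\<And>d. d \<in> {j..n} \<Longrightarrow> d < start_col n m j \<Longrightarrow> co_height n m j d < co_height n m j (start_col n m j)"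
    and "eps_start n j m = co_height n m j (start_col n m j)"
proof -
  have 1: "1 \<le> n + 1 - j" using assms by auto
  note p = end_row_props[OF 1, where m = "flip n m"]
  show "start_col n m j \<in> {j..n}" using p(1) assms by (auto simp: start_col_def)
  have e: "n + 1 - start_col n m j = end_row (flip n m) (n + 1 - j)"
    using p(1) assms by (auto simp: start_col_def)
  show "eps_start n j m = co_height n m j (start_col n m j)"
    by (simp only: eps_start_def eps_end_def co_height_def e)
  fix d assume d: "d \<in> {j..n}"
  then have d': "n + 1 - d \<in> {1..n + 1 - j}" using assms by auto
  show "co_height n m j d \<le> co_height n m j (start_col n m j)"
    unfolding co_height_def e by (rule p(2)[OF d'])
  show "co_height n m j d < co_height n m j (start_col n m j)" if "d < start_col n m j"
    unfolding co_height_def e by (rule p(3)[OF d']) (use that d in \<open>auto simp: start_col_def\<close>)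
qed

lemma start_col_eqI:
  assumes j: "j \<in> {1..n}" and "b \<in> {j..n}" "\<And>d. d \<in> {j..n} \<Longrightarrow> co_height n m j d \<le> co_height n m j b"
    and "\<And>d. d \<in> {j..n} \<Longrightarrow> d < b \<Longrightarrow> co_height n m j d < co_height n m j b"
  shows "start_col n m j = b"
  using start_col_props[OF j, where m = m] assms(2-4) by (meson linorder_neqE_nat not_le)

lemma f_start_eq:
  assumes m: "m \<in> multisegments n" and j: "j \<in> {1..n}"
  shows "f_start n j m = lengthen_start j (start_col n m j) m"
proof -
  have 1: "1 \<le> n + 1 - j" using j by auto
  define a where "a = end_row (flip n m) (n + 1 - j)"
  have a: "1 \<le> a" "a \<le> n + 1 - j" using end_row_props(1)[OF 1, of "flip n m"] by (auto simp: a_def)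
  have "flip n (lengthen_end a (n + 1 - j) (flip n m)) x y = lengthen_start j (n + 1 - a) m x y" for x y
  proof -
    have "m (n + 1 - (n + 1 - x)) (n + 1 - (n + 1 - y)) = m x y"
      using fun_cong[OF fun_cong[OF flip_flip[OF m]], of x y] by (simp add: flip_def)
    moreover have "n + 1 - y = a \<and> n + 1 - x = n + 1 - j \<longleftrightarrow> x = j \<and> y = n + 1 - a"
      and "n + 1 - y = a \<and> n + 1 - x = n + 1 - j - 1 \<and> a < n + 1 - j
        \<longleftrightarrow> x = j + 1 \<and> y = n + 1 - a \<and> j < n + 1 - a"
      using a j unfolding atLeastAtMost_iff by arith+
    ultimately show ?thesis unfolding flip_def lengthen_end_def lengthen_start_def by presburger
  qed
  then show ?thesis by (simp add: f_start_def f_end_def start_col_def a_def fun_eq_iff)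
qed

text \<open>
  The height sees the change in rows \<open>j\<close> and \<open>j + 1\<close> only: beyond them, the sign that row \<open>j\<close> has
  gained is made up for by the one that row \<open>j + 1\<close> has lost.
\<close>

lemma height_lengthen_start:
  assumes "c \<in> {1..i}" "1 \<le> j" "j \<le> b"
  shows "height (lengthen_start j b m) i c
    = height m i c + (if b = i \<and> c = j then 1 else 0) - (if b + 1 = i \<and> c = j + 1 then 1 else 0)"
proof -
  have "(\<Sum>k = 1..c. lengthen_start j b m k i)
      = (\<Sum>k = 1..c. m k i + ((if k = j then (if b = i then 1 else 0) else 0)
          + (if k = j + 1 then (if b = i \<and> j < i then -1 else 0) else 0)))"
    by (intro sum.cong) (auto simp: lengthen_start_def)
  moreover have "(\<Sum>k = 1..<c. lengthen_start j b m k (i - 1))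
      = (\<Sum>k = 1..<c. m k (i - 1) + ((if k = j then (if b + 1 = i then 1 else 0) else 0)
          + (if k = j + 1 then (if b + 1 = i \<and> j < b then -1 else 0) else 0)))"
    using assms by (intro sum.cong) (auto simp: lengthen_start_def)
  ultimately show ?thesis using assms
    by (simp add: height_def sum.distrib sum.delta)
qed

lemma co_height_lengthen_end:
  assumes "a \<in> {1..i}" "i \<le> n" "j \<in> {1..n}" "d \<in> {j..n}"
  shows "co_height n (lengthen_end a i m) j d
    = co_height n m j d + (if a = j \<and> d = i then 1 else 0) - (if a = j + 1 \<and> d + 1 = i then 1 else 0)"
proof -
  have "(\<Sum>k = d..n. lengthen_end a i m j k)
      = (\<Sum>k = d..n. m j k + ((if k = i then (if j = a then 1 else 0) else 0)
          + (if k = i - 1 then (if j = a \<and> a < i then -1 else 0) else 0)))"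
    by (intro sum.cong) (auto simp: lengthen_end_def)
  moreover have "(\<Sum>k = Suc d..n. lengthen_end a i m (Suc j) k)
      = (\<Sum>k = Suc d..n. m (Suc j) k + ((if k = i then (if Suc j = a then 1 else 0) else 0)
          + (if k = i - 1 then (if Suc j = a \<and> a < i then -1 else 0) else 0)))"
    by (intro sum.cong) (auto simp: lengthen_end_def)
  ultimately show ?thesis using assms
    by (simp add: co_height_eq sum.distrib sum.delta) auto
qed

text \<open>
  Both differences equal \<open>m j (i - 1) - m (j + 1) i\<close>, so the first of two neighbours, \<open>j\<close> and \<open>j + 1\<close>
  or \<open>i - 1\<close> and \<open>i\<close>, has the larger value for both functions or for neither. An operator that acts at
  one neighbour can raise the other function only at the opposite neighbour, where it is smaller. This
  is what keeps \<open>f_end i\<close> and \<open>f_start n j\<close> from disturbing each other.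
\<close>

lemma height_co_height_exchange:
  assumes "1 \<le> j" "j < i" "i \<le> n"
  shows "height m i j - height m i (j + 1) = co_height n m j (i - 1) - co_height n m j i"
proof -
  have s: "(\<Sum>d = i - 1..n. f d) = f (i - 1) + (\<Sum>d = i..n. f d)" for f :: "nat \<Rightarrow> int"
    using sum.atLeast_Suc_atMost[of "i - 1" n f] assms by simp
  have t: "(\<Sum>d = i..n. f d) = f i + (\<Sum>d = Suc i..n. f d)" for f :: "nat \<Rightarrow> int"
    using sum.atLeast_Suc_atMost[of i n f] assms by simp
  have "co_height n m j (i - 1) = co_height n m j i + m j (i - 1) - m (Suc j) i"
    using assms s[of "m j"] t[of "m (Suc j)"] by (subst (1 2) co_height_eq) auto
  then show ?thesis using height_Suc[OF assms(1), of m i] by simp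
qed

section \<open>Commutation of the two families of operators\<close>

lemma f_start_inj:
  assumes "m \<in> multisegments n" "m' \<in> multisegments n" "k \<in> {1..n}" "f_start n k m = f_start n k m'"
  shows "m = m'"
proof -
  have k: "1 \<le> n + 1 - k" "n + 1 - k \<in> {1..n}" using assms(3) by auto
  note fm = flip_multisegments[OF assms(1)] flip_multisegments[OF assms(2)]
  have "f_end (n + 1 - k) (flip n m) = f_end (n + 1 - k) (flip n m')"
    using assms(4) flip_flip[OF multisegments_f_end(1)[OF fm(1) k(2)]]
      flip_flip[OF multisegments_f_end(1)[OF fm(2) k(2)]]
    by (simp add: f_start_def)
  then have "flip n m = flip n m'" by (rule f_end_inj[OF k(1)])
  then show ?thesis using flip_flip assms(1,2) by metis
qed

lemma f_start_preimage:
  assumes "m \<in> multisegments n" "k \<in> {1..n}" "0 < eps_start n k m"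
  shows "\<exists>v\<in>multisegments n. f_start n k v = m"
proof -
  have k: "n + 1 - k \<in> {1..n}" using assms(2) by auto
  obtain v where v: "v \<in> multisegments n" "f_end (n + 1 - k) v = flip n m"
    using f_end_preimage[OF flip_multisegments[OF assms(1)] k] assms(3) by (auto simp: eps_start_def)
  then have "f_start n k (flip n v) = m" by (simp add: f_start_def flip_flip assms(1))
  then show ?thesis using flip_multisegments[OF v(1)] by blast
qed

lemma eps_start_f_start:
  assumes "m \<in> multisegments n" "k \<in> {1..n}"
  shows "eps_start n k (f_start n k m) = eps_start n k m + 1"
proof -
  have k: "n + 1 - k \<in> {1..n}" "1 \<le> n + 1 - k" using assms(2) by auto
  show ?thesis using flip_multisegments[OF assms(1)] k
    by (simp add: eps_start_def f_start_def flip_flip[OF multisegments_f_end(1)] eps_end_f_end)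
qed

text \<open>
  Each operator alters the other's height function in at most one place. By
  \<open>height_co_height_exchange\<close> this alteration does not move the maximum, with one exception: if the
  right ends are changed in row \<open>k + 1\<close> and the left ends in column \<open>i - 1\<close>, there is a tie, and both
  maxima move to the neighbour. In the exceptional case both compositions turn \<open>[k + 1, i - 1]\<close> into
  \<open>[k, i]\<close>, through \<open>[k + 1, i]\<close> or through \<open>[k, i - 1]\<close>; for \<open>k + 1 = i\<close> the segment
  \<open>[k + 1, i - 1]\<close> is empty and \<open>[k, i]\<close> is added.
\<close>

lemma f_end_f_start_commute:
  assumes m: "m \<in> multisegments n" and i: "i \<in> {1..n}" and k: "k \<in> {1..n}" and ik: "i \<noteq> k"
  shows "f_end i (f_start n k m) = f_start n k (f_end i m)"
    and "eps_start n k (f_end i m) = eps_start n k m"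
proof -
  define a where "a = end_row m i"
  define b where "b = start_col n m k"
  have i1: "1 \<le> i" using i by simp
  note p = end_row_props[OF i1, where m = m, folded a_def]
  note q = start_col_props[OF k, where m = m, folded b_def]
  define m1 where "m1 = f_end i m"
  define m2 where "m2 = f_start n k m"
  have m1: "m1 = lengthen_end a i m" "m1 \<in> multisegments n"
    using multisegments_f_end(1)[OF m i] by (simp_all add: m1_def f_end_def a_def)
  have m2: "m2 = lengthen_start k b m" by (simp add: m2_def f_start_eq[OF m k] b_def)
  have P2: "height m2 i c = height m i c + (if b = i \<and> c = k then 1 else 0)
      - (if b + 1 = i \<and> c = k + 1 then 1 else 0)" if "c \<in> {1..i}" for c
    unfolding m2 using that q(1) k by (intro height_lengthen_start) auto
  have Q1: "co_height n m1 k d = co_height n m k d + (if a = k \<and> d = i then 1 else 0)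
      - (if a = k + 1 \<and> d + 1 = i then 1 else 0)" if "d \<in> {k..n}" for d
    unfolding m1 using that p(1) k i by (intro co_height_lengthen_end) auto
  have ex: "height m i k - height m i (k + 1) = co_height n m k (i - 1) - co_height n m k i" if "k < i"
    using that i k by (intro height_co_height_exchange) auto
  have eps1: "eps_start n k m1 = eps_start n k m \<and> f_end i m2 = f_start n k m1"
  \<comment> \<open>The only configuration in which the maxima move.\<close>
  proof (cases "a = k + 1 \<and> b + 1 = i")
    case True
    then have ki: "k < i" and a: "a = k + 1" and b: "b = i - 1" using p(1) ik q(1) by auto
    have r: "i \<in> {k..n}" "b \<in> {k..n}" "k \<in> {1..i}" "a \<in> {1..i}" using ki i k a b by auto
    have eq: "height m i k = height m i a" "co_height n m k i = co_height n m k b"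
      using p(2)[OF r(3)] q(2)[OF r(1)] ex[OF ki] by (auto simp: a b)
    have er: "end_row m2 i = k"
    proof (rule end_row_eqI[OF r(3)])
      fix c assume c: "c \<in> {1..i}"
      show "height m2 i c \<le> height m2 i k"
        using P2[OF c] P2[OF r(3)] p(2)[OF c] eq by (auto split: if_splits)
      show "height m2 i c < height m2 i k" if "k < c"
        using P2[OF c] P2[OF r(3)] p(2,3)[OF c] eq True that
        by (cases "c = k + 1") (auto split: if_splits)
    qed
    have sc: "start_col n m1 k = i"
    proof (rule start_col_eqI[OF k r(1)])
      fix d assume d: "d \<in> {k..n}"
      show "co_height n m1 k d \<le> co_height n m1 k i"
        using Q1[OF d] Q1[OF r(1)] q(2)[OF d] eq by (auto split: if_splits)
      show "co_height n m1 k d < co_height n m1 k i" if "d < i"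
        using Q1[OF d] Q1[OF r(1)] q(2,3)[OF d] eq True that
        by (cases "d = b") (auto split: if_splits)
    qed
    have "lengthen_end k i (lengthen_start k b m) = lengthen_start k i (lengthen_end a i m)"
      using ki by (auto simp: fun_eq_iff lengthen_end_def lengthen_start_def a b)
    then have "f_end i m2 = f_start n k m1"
      unfolding f_end_def er f_start_eq[OF m1(2) k] sc by (simp add: m1(1) m2)
    moreover have "eps_start n k m1 = eps_start n k m"
      using start_col_props(4)[OF k, of m1] q(4) Q1[OF r(1)] eq by (simp add: sc a)
    ultimately show ?thesis by simp
  next
    case False
    have r: "a \<in> {1..i}" "b \<in> {k..n}" using p(1) q(1) by auto
    \<comment> \<open>By \<open>sep\<close> and \<open>sep'\<close>, a value that is raised by one was smaller
      than that of its neighbour. It does not exceed the latter now, and in case of a tie the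
      neighbour is the one that counts.\<close>
    have sep: "height m i k < height m i (k + 1)" if "b = i" "k < i"
    proof -
      have "i - 1 \<in> {k..n}" "i - 1 < b" using that i k by auto
      then show ?thesis using q(3)[of "i - 1"] ex[OF that(2)] that(1) by simp
    qed
    have sep': "co_height n m k i < co_height n m k (i - 1)" if "a = k" "k < i"
      using p(3)[of "k + 1"] that i k ex[OF that(2)] by auto
    have er: "end_row m2 i = a"
    proof (rule end_row_eqI[OF r(1)])
      fix c assume c: "c \<in> {1..i}"
      have ki: "k < i" if "b = i" using that r ik by auto
      have s: "height m i k < height m i a" if "b = i"
        using sep[OF that ki[OF that]] p(2)[of "k + 1"] ki[OF that] by auto
      show "height m2 i c \<le> height m2 i a"
        using P2[OF c] P2[OF r(1)] p(2)[OF c] s False by (auto split: if_splits)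
      show "height m2 i c < height m2 i a" if "a < c"
      proof (cases "b = i \<and> c = k")
        case True
        have "height m i k < height m i (k + 1)" using True sep ki by auto
        moreover have "height m i (k + 1) < height m i a"
          using p(3)[of "k + 1"] True that ki by auto
        ultimately show ?thesis using P2[OF c] P2[OF r(1)] True False by (auto split: if_splits)
      next
        case no: False
        then show ?thesis using P2[OF c] P2[OF r(1)] p(3)[OF c that] False by (auto split: if_splits)
      qed
    qed
    have sc: "start_col n m1 k = b"
    proof (rule start_col_eqI[OF k r(2)])
      fix d assume d: "d \<in> {k..n}"
      have ki: "k < i" if "a = k" using that r ik by auto
      have s: "co_height n m k i < co_height n m k b" if "a = k"
      proof -
        have "i - 1 \<in> {k..n}" using ki[OF that] i by auto
        then show ?thesis using sep'[OF that ki[OF that]] q(2)[of "i - 1"] by simp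
      qed
      show "co_height n m1 k d \<le> co_height n m1 k b"
        using Q1[OF d] Q1[OF r(2)] q(2)[OF d] s False by (auto split: if_splits)
      show "co_height n m1 k d < co_height n m1 k b" if "d < b"
      proof (cases "a = k \<and> d = i")
        case True
        have "co_height n m k i < co_height n m k (i - 1)" using True sep' ki by auto
        moreover have "co_height n m k (i - 1) < co_height n m k b"
        proof -
          have "i - 1 \<in> {k..n}" "i - 1 < b" using True that ki i by auto
          then show ?thesis using q(3)[of "i - 1"] by simp
        qed
        ultimately show ?thesis using Q1[OF d] Q1[OF r(2)] True False by (auto split: if_splits)
      next
        case no: False
        then show ?thesis using Q1[OF d] Q1[OF r(2)] q(3)[OF d that] False by (auto split: if_splits)
      qed
    qed
    have "b \<noteq> i \<or> a \<noteq> k" 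
    proof (rule ccontr)
      assume "\<not> ?thesis"
      then have "a = k" "b = i" "k < i" using ik r(1) by auto
      then show False using sep sep' ex by simp
    qed
    then have "co_height n m1 k b = co_height n m k b"
      using Q1[OF r(2)] False by auto
    moreover have "lengthen_end a i (lengthen_start k b m) = lengthen_start k b (lengthen_end a i m)"
      by (auto simp: fun_eq_iff lengthen_end_def lengthen_start_def)
    ultimately show ?thesis
      using start_col_props(4)[OF k, of m1] q(4)
      unfolding f_end_def er f_start_eq[OF m1(2) k] sc by (simp add: m1(1) m2)
  qed
  then show "f_end i (f_start n k m) = f_start n k (f_end i m)" "eps_start n k (f_end i m) = eps_start n k m"
    by (auto simp: m1_def m2_def)
qed

text \<open>
  How far the values at the short segment \<open>[i, i]\<close> are below the maxima, for both height functions
  together. In crystal notation this is \<open>\<epsilon>\<^sub>i + \<epsilon>\<^sub>i\<^sup>* + wt\<^sub>i\<close>, because the sum of the two values at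
  \<open>[i, i]\<close> depends on the weight only.
\<close>

definition slack :: "nat \<Rightarrow> nat \<Rightarrow> multisegment \<Rightarrow> int" where
  "slack n i m = (eps_end i m - height m i i) + (eps_start n i m - co_height n m i i)"

lemma slack_parts:
  assumes "i \<in> {1..n}"
  shows "height m i i \<le> eps_end i m" "height m i i = eps_end i m \<longleftrightarrow> end_row m i = i"
    and "co_height n m i i \<le> eps_start n i m" "co_height n m i i = eps_start n i m \<longleftrightarrow> start_col n m i = i"
proof -
  have i: "1 \<le> i" "i \<in> {1..i}" "i \<in> {i..n}" using assms by auto
  show "height m i i \<le> eps_end i m" using end_row_props(2)[OF i(1,2)] by (simp add: eps_end_def)
  show "height m i i = eps_end i m \<longleftrightarrow> end_row m i = i"
    using end_row_props(1,3)[OF i(1)] i(2) unfolding eps_end_def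
    by (metis atLeastAtMost_iff le_neq_implies_less order_less_irrefl)
  note p = start_col_props[OF assms, where m = m]
  show "co_height n m i i \<le> eps_start n i m" using p(2)[OF i(3)] by (simp add: p(4))
  show "co_height n m i i = eps_start n i m \<longleftrightarrow> start_col n m i = i"
    using p(1) p(3)[OF i(3)] unfolding p(4)
    by (metis atLeastAtMost_iff le_neq_implies_less order_less_irrefl)
qed

text \<open>
  With both maxima at \<open>[i, i]\<close>, either operator adds the segment \<open>[i, i]\<close>.
\<close>

lemma f_end_eq_f_start:
  assumes "m \<in> multisegments n" "i \<in> {1..n}" "slack n i m = 0"
  shows "f_end i m = f_start n i m"
proof -
  have "end_row m i = i" "start_col n m i = i"
    using slack_parts[OF assms(2), of m] assms(3) by (auto simp: slack_def)
  then show ?thesis using assms(1,2)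
    by (simp add: f_end_def f_start_eq lengthen_end_def lengthen_start_def)
qed

text \<open>
  For equal indices the operators can see each other only through the segment \<open>[i, i]\<close>: adding it
  raises the other height function at its end point \<open>i\<close> by one. With a slack of at least \<open>2\<close> this
  cannot create a new maximum that wins against the old one. A slack of exactly \<open>1\<close> is the case
  without commutation.
\<close>

lemma
  assumes m: "m \<in> multisegments n" and i: "i \<in> {1..n}"
  shows slack_f_start: "slack n i (f_start n i m) = max 0 (slack n i m - 1)"
    and eps_start_f_end: "slack n i m \<noteq> 0 \<Longrightarrow> eps_start n i (f_end i m) = eps_start n i m"
    and f_end_f_start_commute_same:
      "2 \<le> slack n i m \<Longrightarrow> f_end i (f_start n i m) = f_start n i (f_end i m)"
proof -
  define a where "a = end_row m i"
  define b where "b = start_col n m i"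
  have i1: "1 \<le> i" "i \<in> {1..i}" "i \<in> {i..n}" using i by auto
  note p = end_row_props[OF i1(1), where m = m, folded a_def]
  note q = start_col_props[OF i, where m = m, folded b_def]
  define m1 where "m1 = f_end i m"
  define m2 where "m2 = f_start n i m"
  have m1: "m1 = lengthen_end a i m" "m1 \<in> multisegments n"
    using multisegments_f_end(1)[OF m i] by (simp_all add: m1_def f_end_def a_def)
  have m2: "m2 = lengthen_start i b m" "m2 \<in> multisegments n"
    using f_start_multisegments[OF m i] by (simp_all add: m2_def f_start_eq[OF m i] b_def)
  have P2: "height m2 i c = height m i c + (if b = i \<and> c = i then 1 else 0)" if "c \<in> {1..i}" for c
    unfolding m2 using that q(1) i by (subst height_lengthen_start) auto
  have Q1: "co_height n m1 i d = co_height n m i d + (if a = i \<and> d = i then 1 else 0)"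
    if "d \<in> {i..n}" for d
    unfolding m1 using that p(1) i by (subst co_height_lengthen_end) auto
  have A: "height m i i \<le> eps_end i m" "height m i i = eps_end i m \<longleftrightarrow> a = i"
    and B: "co_height n m i i \<le> eps_start n i m" "co_height n m i i = eps_start n i m \<longleftrightarrow> b = i"
    using slack_parts[OF i, of m] by (auto simp: a_def b_def)
  have r: "a \<in> {1..i}" "b \<in> {i..n}" using p(1) q(1) by auto
  have e: "eps_end i m = height m i a" by (simp add: eps_end_def a_def)

  \<comment> \<open>The value at \<open>i\<close>, the first column, rises by two unless the change is made in
    that column.\<close>
  have Q2: "co_height n m2 i i = co_height n m i i + (if b = i then 1 else 2)"
  proof -
    have 1: "n + 1 - i \<in> {1..n + 1 - i}" "n + 1 - i \<in> {1..n}" using i by auto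
    have "flip n m2 = f_end (n + 1 - i) (flip n m)"
      unfolding m2_def f_start_def
      by (intro flip_flip multisegments_f_end(1) flip_multisegments m 1)
    moreover have "end_row (flip n m) (n + 1 - i) \<in> {1..n + 1 - i}"
      using 1 by (intro end_row_props) auto
    ultimately show ?thesis using height_f_end[OF 1(1), of "flip n m"] i
      by (auto simp: co_height_def b_def start_col_def split: if_splits)
  qed
  have E2: "eps_end i m2 = eps_end i m + (if a = i \<and> b = i then 1 else 0)"
    (is "_ = ?e")
  proof (rule eps_end_eqI[OF r(1)])
    show "height m2 i a = ?e" using P2[OF r(1)] e by auto
    show "height m2 i c \<le> ?e" if c: "c \<in> {1..i}" for c
      using P2[OF c] p(2)[OF c] A e by (auto split: if_splits)
  qed
  show "slack n i (f_start n i m) = max 0 (slack n i m - 1)"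
    using E2 Q2 P2[OF i1(2)] eps_start_f_start[OF m i] A B
    unfolding slack_def m2_def[symmetric] by (auto simp: max_def)
  have S1: "start_col n m1 i = b" if "\<not> (a = i \<and> b \<noteq> i \<and> eps_start n i m = co_height n m i i + 1)"
  proof (rule start_col_eqI[OF i r(2)])
    fix d assume d: "d \<in> {i..n}"
    show "co_height n m1 i d \<le> co_height n m1 i b"
      using Q1[OF d] Q1[OF r(2)] q(2)[OF d] q(4) B that by (auto split: if_splits)
    show "co_height n m1 i d < co_height n m1 i b" if "d < b"
      using Q1[OF d] Q1[OF r(2)] q(3)[OF d that] q(4) B that \<open>\<not> (a = i \<and> _)\<close> by (auto split: if_splits)
  qed
  show "eps_start n i (f_end i m) = eps_start n i m" if "slack n i m \<noteq> 0"
  proof -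
    have "eps_start n i m1 = co_height n m1 i (start_col n m1 i)" by (rule start_col_props(4)[OF i])
    have ab: "\<not> (a = i \<and> b = i)" using that A B by (auto simp: slack_def)
    show ?thesis
    proof (rule antisym)
      show "eps_start n i (f_end i m) \<le> eps_start n i m"
        using start_col_props(1,4)[OF i, of m1] Q1[of "start_col n m1 i"] q(2)[of "start_col n m1 i"] q(4) B ab
        by (auto simp: m1_def[symmetric] split: if_splits)
      show "eps_start n i m \<le> eps_start n i (f_end i m)"
        using start_col_props(2)[OF i r(2), of m1] start_col_props(4)[OF i, of m1] Q1[OF r(2)] q(4)
        by (auto simp: m1_def[symmetric] split: if_splits)
    qed
  qed
  show "f_end i (f_start n i m) = f_start n i (f_end i m)" if "2 \<le> slack n i m"
  proof -
    have "start_col n m1 i = b" using that A by (intro S1) (auto simp: slack_def)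
    moreover have "end_row m2 i = a"
    proof (rule end_row_eqI[OF r(1)])
      fix c assume c: "c \<in> {1..i}"
      have ab: "b = i \<Longrightarrow> height m i i + 2 \<le> eps_end i m" using that B by (auto simp: slack_def)
      show "height m2 i c \<le> height m2 i a"
        using P2[OF c] P2[OF r(1)] p(2)[OF c] ab e by (auto split: if_splits)
      show "height m2 i c < height m2 i a" if "a < c"
        using P2[OF c] P2[OF r(1)] p(3)[OF c that] ab e by (auto split: if_splits)
    qed
    moreover have "lengthen_end a i (lengthen_start i b m) = lengthen_start i b (lengthen_end a i m)"
      by (auto simp: fun_eq_iff lengthen_end_def lengthen_start_def)
    ultimately show ?thesis
      unfolding m1_def[symmetric] m2_def[symmetric] f_start_eq[OF m1(2) i]
      by (simp add: f_end_def m1(1) m2(1))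
  qed
qed

section \<open>Exchanging the two families of operators\<close>

text \<open>
  The graph of the involution that exchanges both families of operators. Both closure rules are
  included, so that the relation is symmetric by construction.
\<close>

inductive dual :: "nat \<Rightarrow> multisegment \<Rightarrow> multisegment \<Rightarrow> bool" for n where
  empty: "dual n (\<lambda>_ _. 0) (\<lambda>_ _. 0)"
| f_end: "\<lbrakk>dual n m m'; i \<in> {1..n}\<rbrakk> \<Longrightarrow> dual n (f_end i m) (f_start n i m')"
| f_start: "\<lbrakk>dual n m m'; i \<in> {1..n}\<rbrakk> \<Longrightarrow> dual n (f_start n i m) (f_end i m')"

lemma zero_multisegments: "(\<lambda>_ _. 0) \<in> multisegments n"
  by (simp add: multisegments_def)

lemma dual_multisegments: "dual n m m' \<Longrightarrow> m \<in> multisegments n \<and> m' \<in> multisegments n"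
  by (induction rule: dual.induct) (auto simp: zero_multisegments multisegments_f_end(1) f_start_multisegments)

lemma dual_sym: "dual n m m' \<Longrightarrow> dual n m' m"
  by (induction rule: dual.induct) (auto intro: dual.intros)

text \<open>
  The sum of the lengths of all segments: the rank on which the uniqueness proof is by induction.
\<close>

definition total_length :: "nat \<Rightarrow> multisegment \<Rightarrow> int" where
  "total_length n m = (\<Sum>a = 1..n. \<Sum>b = 1..n. (int b + 1 - int a) * m a b)"

lemma total_length_nonneg:
  assumes "m \<in> multisegments n"
  shows "0 \<le> total_length n m"
  unfolding total_length_def
proof (intro sum_nonneg)
  fix a b
  show "0 \<le> (int b + 1 - int a) * m a b"
  proof (cases "m a b = 0")
    case False
    then have "0 \<le> m a b" "a \<le> b" using assms by (auto simp: multisegments_def)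
    then show ?thesis by simp
  qed simp
qed

lemma total_length_f_end:
  assumes "i \<in> {1..n}"
  shows "total_length n (f_end i m) = total_length n m + 1"
proof -
  define a where "a = end_row m i"
  have a: "a \<in> {1..i}" "a \<in> {1..n}" using end_row_props(1)[of i m] assms by (auto simp: a_def)
  have "(\<Sum>y = 1..n. (int y + 1 - int x) * lengthen_end a i m x y)
      = (\<Sum>y = 1..n. (int y + 1 - int x) * m x y) + (if x = a then 1 else 0)" for x
  proof -
    have "(\<Sum>y = 1..n. (int y + 1 - int x) * lengthen_end a i m x y)
      = (\<Sum>y = 1..n. (int y + 1 - int x) * m x y
          + ((if y = i then (if x = a then int i + 1 - int a else 0) else 0)
          + (if y = i - 1 then (if x = a \<and> a < i then int a - int i else 0) else 0)))"
      using a by (intro sum.cong) (auto simp: lengthen_end_def algebra_simps)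
    then show ?thesis using a assms by (simp add: sum.distrib sum.delta) auto
  qed
  then show ?thesis using a by (simp add: total_length_def f_end_def a_def[symmetric] sum.distrib sum.delta)
qed

lemma total_length_flip: "total_length n (flip n m) = total_length n m"
proof -
  have "total_length n (flip n m)
      = (\<Sum>a = 1..n. \<Sum>b = 1..n. (int (n + 1 - a) + 1 - int (n + 1 - b)) * m (n + 1 - b) (n + 1 - a))"
    unfolding total_length_def flip_def by (intro sum.cong) (auto simp: of_nat_diff)
  also have "\<dots> = (\<Sum>b = 1..n. \<Sum>a = 1..n. (int (n + 1 - a) + 1 - int (n + 1 - b)) * m (n + 1 - b) (n + 1 - a))"
    by (rule sum.swap)
  also have "\<dots> = (\<Sum>b = 1..n. \<Sum>a = 1..n. (int a + 1 - int (n + 1 - b)) * m (n + 1 - b) a)"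
    by (rule sum.cong[OF refl], rule sum.reindex_bij_witness[where i = "\<lambda>x. n + 1 - x" and j = "\<lambda>x. n + 1 - x"])
       auto
  also have "\<dots> = total_length n m"
    unfolding total_length_def
    by (rule sum.reindex_bij_witness[where i = "\<lambda>x. n + 1 - x" and j = "\<lambda>x. n + 1 - x"]) auto
  finally show ?thesis .
qed

lemma total_length_f_start:
  "i \<in> {1..n} \<Longrightarrow> total_length n (f_start n i m) = total_length n m + 1"
  unfolding f_start_def total_length_flip by (subst total_length_f_end) (auto simp: total_length_flip)

lemma total_length_dual: "dual n m m' \<Longrightarrow> total_length n m' = total_length n m"
  by (induction rule: dual.induct) (simp_all add: total_length_f_end total_length_f_start)

text \<open>
  Up to sign, the pairing of the weight of \<open>m\<close> with the \<open>i\<close>-th simple coroot. Being determined by the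
  weight, it changes by the same amount under \<open>f_end k\<close> and \<open>f_start n k\<close>.
\<close>

definition pairing :: "nat \<Rightarrow> nat \<Rightarrow> multisegment \<Rightarrow> int" where
  "pairing n i m = height m i i + co_height n m i i"

definition cartan :: "nat \<Rightarrow> nat \<Rightarrow> int" where
  "cartan i k = (if i = k then 2 else if i = k + 1 \<or> k = i + 1 then - 1 else 0)"

lemma height_diag_lengthen_end:
  assumes "a \<in> {1..k}" "1 \<le> i"
  shows "height (lengthen_end a k m) i i = height m i i
    + (if i = k then (if a = i then 1 else 2) else if k = i + 1 then (if a \<le> i then - 1 else 0)
       else if i = k + 1 then - 1 else 0)"
proof -
  have "(\<Sum>c = 1..i. lengthen_end a k m c i)
      = (\<Sum>c = 1..i. m c i + (if c = a then (if i = k then 1 else if k = i + 1 \<and> a < k then -1 else 0) else 0))"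
    using assms by (intro sum.cong) (auto simp: lengthen_end_def)
  moreover have "(\<Sum>c = 1..<i. lengthen_end a k m c (i - 1))
      = (\<Sum>c = 1..<i. m c (i - 1) + (if c = a then (if i = k + 1 then 1 else if k = i \<and> a < k then -1 else 0) else 0))"
    using assms by (intro sum.cong) (auto simp: lengthen_end_def)
  ultimately show ?thesis using assms
    by (auto simp add: height_def sum.distrib sum.delta)
qed

lemma pairing_f_end:
  assumes "i \<in> {1..n}" "k \<in> {1..n}"
  shows "pairing n i (f_end k m) = pairing n i m + cartan i k"
proof -
  have a: "end_row m k \<in> {1..k}" using end_row_props(1)[of k m] assms by auto
  show ?thesis unfolding pairing_def f_end_def
    using height_diag_lengthen_end[OF a, of i m] co_height_lengthen_end[OF a, of n i i m] assms a
    by (auto simp: cartan_def)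
qed

lemma pairing_flip:
  assumes "m \<in> multisegments n" "i \<in> {1..n}"
  shows "pairing n (n + 1 - i) (flip n m) = pairing n i m"
  using assms by (simp add: pairing_def co_height_def flip_flip)

lemma pairing_f_start:
  assumes "i \<in> {1..n}" "k \<in> {1..n}" "m \<in> multisegments n"
  shows "pairing n i (f_start n k m) = pairing n i m + cartan i k"
proof -
  have r: "n + 1 - i \<in> {1..n}" "n + 1 - k \<in> {1..n}" using assms by auto
  note fm = flip_multisegments[OF assms(3)]
  have "pairing n i (f_start n k m) = pairing n (n + 1 - i) (flip n (f_start n k m))"
    by (rule pairing_flip[symmetric]) (use assms f_start_multisegments in auto)
  also have "flip n (f_start n k m) = f_end (n + 1 - k) (flip n m)"
    unfolding f_start_def by (intro flip_flip multisegments_f_end(1)[OF fm] r)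
  also have "pairing n (n + 1 - i) \<dots> = pairing n i m + cartan (n + 1 - i) (n + 1 - k)"
    by (simp only: pairing_f_end[OF r] pairing_flip[OF assms(3,1)])
  also have "cartan (n + 1 - i) (n + 1 - k) = cartan i k"
  proof -
    have "n + 1 - i = n + 1 - k \<longleftrightarrow> i = k" "n + 1 - i = n + 1 - k + 1 \<longleftrightarrow> k = i + 1"
      "n + 1 - k = n + 1 - i + 1 \<longleftrightarrow> i = k + 1"
      using assms unfolding atLeastAtMost_iff by arith+
    then show ?thesis unfolding cartan_def by presburger
  qed
  finally show ?thesis .
qed

lemma pairing_dual:
  assumes "dual n m m'" "i \<in> {1..n}"
  shows "pairing n i m' = pairing n i m"
  using assms
  by (induction rule: dual.induct)
     (auto simp: pairing_f_end pairing_f_start dual_multisegments)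

lemma multisegment_f_end_cases:
  assumes "m \<in> multisegments n"
  obtains "m = (\<lambda>_ _. 0)" | i k where "i \<in> {1..n}" "k \<in> multisegments n" "m = f_end i k"
  using eps_end_pos_ex[OF assms] f_end_preimage[OF assms] by metis

lemma multisegment_f_start_cases:
  assumes "m \<in> multisegments n"
  obtains "m = (\<lambda>_ _. 0)" | i k where "i \<in> {1..n}" "k \<in> multisegments n" "m = f_start n i k"
proof (rule multisegment_f_end_cases[OF flip_multisegments[OF assms]])
  assume *: "flip n m = (\<lambda>_ _. 0)"
  have "m = flip n (flip n m)" using flip_flip[OF assms] by simp
  also have "\<dots> = (\<lambda>_ _. 0)" unfolding * by (simp add: flip_def)
  finally show ?thesis using that(1) by blast
next
  fix i k assume *: "i \<in> {1..n}" "k \<in> multisegments n" "flip n m = f_end i k"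
  have "m = flip n (flip n m)" using flip_flip[OF assms] by simp
  also have "\<dots> = f_start n (n + 1 - i) (flip n k)" using * by (simp add: f_start_def flip_flip)
  finally have "m = f_start n (n + 1 - i) (flip n k)" .
  moreover have "n + 1 - i \<in> {1..n}" using *(1) by auto
  ultimately show ?thesis using that(2) flip_multisegments[OF *(2)] by blast
qed

lemma multisegments_induct [consumes 1, case_names empty f_end]:
  assumes "m \<in> multisegments n" and "P (\<lambda>_ _. 0)"
    and "\<And>i k. i \<in> {1..n} \<Longrightarrow> k \<in> multisegments n \<Longrightarrow> P k \<Longrightarrow> P (f_end i k)"
  shows "P m"
  using assms(1)
proof (induction "nat (total_length n m)" arbitrary: m rule: less_induct)
  case less
  show ?case
  proof (cases rule: multisegment_f_end_cases[OF less.prems])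
    case (2 i k)
    then have "nat (total_length n k) < nat (total_length n m)"
      using total_length_f_end[OF 2(1), of k] total_length_nonneg[OF 2(2)] by simp
    then show ?thesis using less.hyps 2 assms(3) by blast
  qed (use assms(2) in simp)
qed

lemma dual_total: "m \<in> multisegments n \<Longrightarrow> \<exists>m'. dual n m m'"
  by (induction rule: multisegments_induct) (blast intro: dual.intros)+

text \<open>
  The core is the claim \<open>diamond\<close>: a presentation \<open>m = f_end i p\<close> and a presentation
  \<open>m = f_start n k q\<close> lead to the same partner. If \<open>p \<noteq> q\<close>, the value of \<open>eps_start\<close> is the same at
  \<open>m\<close> and at \<open>p\<close>, so the step \<open>f_start n k\<close> can already be undone at \<open>p\<close>, and one obtains a square
  below \<open>m\<close>. The partner of the bottom corner of this square spans a square too: for \<open>i = k\<close> because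
  partners have equal slack, which is where \<open>eps\<close> enters.
\<close>

lemma dual_unique_step:
  assumes uniq: "\<And>k x y. total_length n k < total_length n m \<Longrightarrow> dual n k x \<Longrightarrow> dual n k y \<Longrightarrow> x = y"
    and eps: "\<And>k x i. total_length n k < total_length n m \<Longrightarrow> dual n k x \<Longrightarrow> i \<in> {1..n}
      \<Longrightarrow> eps_end i k = eps_start n i x"
    and "dual n m x" "dual n m y"
  shows "x = y"
proof -
  note msD = dual_multisegments[THEN conjunct1] dual_multisegments[THEN conjunct2]
  have diamond: "f_start n i x' = f_end k y'"
    if mx: "m = f_end i p" "i \<in> {1..n}" "dual n p x'" and my: "m = f_start n k q" "k \<in> {1..n}" "dual n q y'"
    for i k p q x' y'
  proof -
    have mem: "p \<in> multisegments n" "q \<in> multisegments n" "x' \<in> multisegments n" "y' \<in> multisegments n"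
      using msD mx(3) my(3) by blast+
    have lp: "total_length n p < total_length n m"
      and lq: "total_length n q < total_length n m"
      using total_length_f_end[OF mx(2), of p] total_length_f_start[OF my(2), of q] mx(1) my(1) by simp_all
    have eq: "f_end i p = f_start n k q" using mx my by simp
    have square: ?thesis if v: "v \<in> multisegments n" "p = f_start n k v"
        and comm: "f_end i (f_start n k v) = f_start n k (f_end i v)"
        and comm': "\<And>v'. dual n v v' \<Longrightarrow> f_end k (f_start n i v') = f_start n i (f_end k v')" for v
    proof -
      obtain v' where v': "dual n v v'" using dual_total[OF v(1)] by blast
      have "f_start n k (f_end i v) = f_start n k q" using eq comm v(2) by simp
      then have q: "q = f_end i v"
        using f_start_inj[OF multisegments_f_end(1)[OF v(1) mx(2)] mem(2) my(2)] by simp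
      have "x' = f_end k v'" using uniq[OF lp mx(3)] dual.f_start[OF v' my(2)] v(2) by simp
      moreover have "y' = f_start n i v'" using uniq[OF lq my(3)] dual.f_end[OF v' mx(2)] q by simp
      ultimately show ?thesis using comm'[OF v'] by simp
    qed
    show ?thesis
    proof (cases "i = k")
      case False
      have "0 < eps_start n k (f_start n k q)"
        using eps_start_f_start[OF mem(2) my(2)] eps_end_nonneg[OF flip_multisegments[OF mem(2)], of "n + 1 - k"] my(2)
        by (auto simp: eps_start_def)
      then have "0 < eps_start n k p"
        using eq f_end_f_start_commute(2)[OF mem(1) mx(2) my(2) False] by simp
      then obtain v where v: "v \<in> multisegments n" "p = f_start n k v"
        using f_start_preimage[OF mem(1) my(2)] by metis
      show ?thesis
      proof (rule square[OF v])
        show "f_end i (f_start n k v) = f_start n k (f_end i v)"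
          by (rule f_end_f_start_commute(1)[OF v(1) mx(2) my(2) False])
        show "f_end k (f_start n i v') = f_start n i (f_end k v')" if "dual n v v'" for v'
          by (rule f_end_f_start_commute(1)[OF msD(2)[OF that] my(2) mx(2)]) (use False in simp)
      qed
    next
      case True
      have slack: "slack n i u' = slack n i u"
        if "total_length n u < total_length n m" "dual n u u'" for u u'
      proof -
        have "eps_end i u = eps_start n i u'" by (rule eps[OF that mx(2)])
        moreover have "eps_end i u' = eps_start n i u"
          by (rule eps[OF _ dual_sym[OF that(2)] mx(2)]) (use that total_length_dual in simp)
        moreover have "pairing n i u' = pairing n i u" by (rule pairing_dual[OF that(2) mx(2)])
        ultimately show ?thesis by (simp add: slack_def pairing_def)
      qed
      show ?thesis
      proof (cases "slack n i p = 0")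
        case z: True
        then have "f_start n k p = f_start n k q" using f_end_eq_f_start[OF mem(1) mx(2)] eq True by simp
        then have "p = q" by (rule f_start_inj[OF mem(1,2) my(2)])
        then have "x' = y'" using uniq[OF lp mx(3)] my(3) by simp
        moreover have "slack n i x' = 0" using slack[OF lp mx(3)] z by simp
        ultimately show ?thesis using f_end_eq_f_start[OF mem(3) mx(2)] True by simp
      next
        case nz: False
        have "0 < eps_start n k (f_start n k q)"
          using eps_start_f_start[OF mem(2) my(2)] eps_end_nonneg[OF flip_multisegments[OF mem(2)], of "n + 1 - k"] my(2)
          by (auto simp: eps_start_def)
        then have "0 < eps_start n k p"
          using eq eps_start_f_end[OF mem(1) mx(2) nz] True by simp
        then obtain v where v: "v \<in> multisegments n" "p = f_start n k v"
          using f_start_preimage[OF mem(1) my(2)] by metis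
        have s: "2 \<le> slack n i v" using slack_f_start[OF v(1) mx(2)] v(2) True nz by auto
        have lv: "total_length n v < total_length n m"
          using lp total_length_f_start[OF my(2), of v] v(2) by simp
        show ?thesis
        proof (rule square[OF v])
          show "f_end i (f_start n k v) = f_start n k (f_end i v)"
            using f_end_f_start_commute_same[OF v(1) mx(2) s] True by simp
          show "f_end k (f_start n i v') = f_start n i (f_end k v')" if "dual n v v'" for v'
            using f_end_f_start_commute_same[OF msD(2)[OF that] mx(2)] slack[OF lv that] s True by simp
        qed
      qed
    qed
  qed

  show "x = y"
  proof (cases "total_length n m = 0")
    case True
    have "z = (\<lambda>_ _. 0)" if "dual n m z" for z
      using that
    proof cases
      case (f_end k k' i)
      then show ?thesis
        using True total_length_f_end[of i n k] total_length_nonneg[OF msD(1)[OF f_end(3)]] by simp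
    next
      case (f_start k k' i)
      then show ?thesis
        using True total_length_f_start[of i n k] total_length_nonneg[OF msD(1)[OF f_start(3)]] by simp
    qed simp
    then show ?thesis using assms(3,4) by blast
  next
    case False
    have mem: "m \<in> multisegments n" using msD assms(3) by blast
    have nz: "m \<noteq> (\<lambda>_ _. 0)" using False by (auto simp: total_length_def)
    obtain i p where p: "i \<in> {1..n}" "p \<in> multisegments n" "m = f_end i p"
      using multisegment_f_end_cases[OF mem] nz by metis
    obtain k q where q: "k \<in> {1..n}" "q \<in> multisegments n" "m = f_start n k q"
      using multisegment_f_start_cases[OF mem] nz by metis
    obtain p' where p': "dual n p p'" using dual_total[OF p(2)] by blast
    obtain q' where q': "dual n q q'" using dual_total[OF q(2)] by blast
    \<comment> \<open>One fixed presentation of each kind, against which all others are compared.\<close>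
    have pq: "f_start n i p' = f_end k q'" by (rule diamond[OF p(3,1) p' q(3,1) q'])
    have "z = f_end k q'" if "dual n m z" for z
      using that
    proof cases
      case empty
      then show ?thesis using nz by simp
    next
      case (f_end u u' j)
      then show ?thesis using diamond[OF f_end(1,4,3) q(3,1) q'] by simp
    next
      case (f_start u u' j)
      then show ?thesis using diamond[OF p(3,1) p' f_start(1,4,3)] pq by simp
    qed
    then show ?thesis using assms(3,4) by blast
  qed
qed

text \<open>
  Both claims are proved together, since the uniqueness of the partner of \<open>m\<close> uses the equality of
  \<open>eps_end\<close> and \<open>eps_start\<close> for shorter multisegments. In turn, uniqueness transfers the last step of a
  presentation of \<open>m\<close> to its partner and back, which shows the equality for \<open>m\<close>.
\<close>

lemma dual_unique_eps:
  "dual n m x \<Longrightarrow> (\<forall>y. dual n m y \<longrightarrow> x = y) \<and> (\<forall>i\<in>{1..n}. eps_end i m = eps_start n i x)"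
proof (induction "nat (total_length n m)" arbitrary: m x rule: less_induct)
  case less
  note msD = dual_multisegments[THEN conjunct1] dual_multisegments[THEN conjunct2]
  have lt: "nat (total_length n k) < nat (total_length n m)"
    if "total_length n k < total_length n m" "dual n k z" for k z
    using that total_length_nonneg[of k n] msD(1)[OF that(2)] by simp
  have IH: "x = y" if "total_length n k < total_length n m" "dual n k x" "dual n k y" for k x y
    using less.hyps[OF lt[OF that(1,2)] that(2)] that(3) by blast
  have IH': "eps_end i k = eps_start n i x"
    if "total_length n k < total_length n m" "dual n k x" "i \<in> {1..n}" for k x i
    using less.hyps[OF lt[OF that(1,2)] that(2)] that(3) by blast
  have uniq: "u = v" if "dual n w u" "dual n w v" "total_length n w = total_length n m" for u v w
    by (rule dual_unique_step[OF IH[folded that(3)] IH'[folded that(3)] that(1,2)])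
  have "eps_end i m = eps_start n i x" if i: "i \<in> {1..n}" for i
  proof -
    note mem = msD[OF less.prems]
    have i': "1 \<le> i" "1 \<le> n + 1 - i" using i by auto
    have nonneg: "0 \<le> eps_end i m" "0 \<le> eps_start n i x"
      using eps_end_nonneg[OF mem(1) i'(1)] eps_end_nonneg[OF flip_multisegments[OF mem(2)] i'(2)]
      by (simp_all add: eps_start_def)
    consider "0 < eps_end i m" | "eps_end i m = 0" "0 < eps_start n i x" | "eps_end i m = eps_start n i x"
      using nonneg by linarith
    then show ?thesis
    proof cases
      case 1
      then obtain k where k: "k \<in> multisegments n" "f_end i k = m"
        using f_end_preimage[OF mem(1) i] by blast
      obtain k' where k': "dual n k k'" using dual_total[OF k(1)] by blast
      have x: "x = f_start n i k'" using uniq[OF less.prems] dual.f_end[OF k' i] k(2) by simp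
      have "total_length n k < total_length n m" using total_length_f_end[OF i, of k] k(2) by simp
      then have "eps_end i k = eps_start n i k'" using IH' k' i by blast
      then show ?thesis
        using eps_start_f_start[OF msD(2)[OF k'] i] eps_end_f_end[OF i'(1), of k] x k(2) by simp
    next
      case 2
      then obtain v where v: "v \<in> multisegments n" "f_start n i v = x"
        using f_start_preimage[OF mem(2) i] by blast
      obtain v' where v': "dual n v v'" using dual_total[OF v(1)] by blast
      have "m = f_end i v'"
      proof (rule uniq[OF dual_sym[OF less.prems]])
        show "dual n x (f_end i v')" using dual.f_start[OF v' i] v(2) by simp
      qed (rule total_length_dual[OF less.prems])
      then have "eps_end i m = eps_end i v' + 1" using eps_end_f_end[OF i'(1)] by simp
      then show ?thesis using 2 eps_end_nonneg[OF msD(2)[OF v'] i'(1)] by simp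
    qed
  qed
  then show ?case using uniq less.prems by blast
qed

lemma dual_unique: "dual n m x \<Longrightarrow> dual n m y \<Longrightarrow> x = y"
  using dual_unique_eps by blast

section \<open>Cancellation of signs and partial sums\<close>

text \<open>
  An order-preserving numbering of the boxes in rows \<open>0, \<dots>, n\<close>. It makes the reading order of a
  tableau an order on natural numbers. Row \<open>0\<close> contains no boxes and only serves as padding.
\<close>

definition reading_position :: "nat \<Rightarrow> box \<Rightarrow> nat" where
  "reading_position n = (\<lambda>(j, c). c * (n + 1) + j)"

definition box_at :: "nat \<Rightarrow> nat \<Rightarrow> box" where
  "box_at n k = (k mod (n + 1), k div (n + 1))"

definition sign :: "nat \<Rightarrow> nat option \<Rightarrow> int" where
  "sign i x = (if x = Some i then 1 else if x = Some (i + 1) then - 1 else 0)"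

text \<open>
  The surplus of plus signs over minus signs before reading position \<open>x\<close>.
\<close>

definition balance :: "nat \<Rightarrow> nat \<Rightarrow> tableau \<Rightarrow> nat \<Rightarrow> int" where
  "balance n i T x = (\<Sum>k<x. sign i (T (box_at n k)))"

definition rows_bounded :: "nat \<Rightarrow> tableau \<Rightarrow> bool" where
  "rows_bounded n T \<longleftrightarrow> (\<forall>j c. T (j, c) \<noteq> None \<longrightarrow> j \<in> {1..n})"

lemma balance_Suc: "balance n i T (Suc x) = balance n i T x + sign i (T (box_at n x))"
  by (simp add: balance_def)

lemma reading_position_box_at: "reading_position n (box_at n k) = k"
  unfolding reading_position_def box_at_def by (simp only: prod.case) (rule div_mult_mod_eq)

lemma box_at_reading_position: "fst p \<le> n \<Longrightarrow> box_at n (reading_position n p) = p"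
proof -
  assume "fst p \<le> n"
  then have "fst p mod (n + 1) = fst p" "fst p div (n + 1) = 0" by simp_all
  then have "(snd p * (n + 1) + fst p) mod (n + 1) = fst p" "(snd p * (n + 1) + fst p) div (n + 1) = snd p"
    by (simp_all only: mod_mult_self3 div_mult_self3 add_0_right)
  then show ?thesis by (simp only: reading_position_def box_at_def case_prod_beta prod.collapse)
qed

lemma read_before_box_at: "box_at n k \<prec> box_at n l \<longleftrightarrow> k < l"
proof -
  have "k div (n + 1) < l div (n + 1) \<Longrightarrow> k < l" by (meson div_le_mono not_less)
  moreover have "k < l \<longleftrightarrow> k mod (n + 1) < l mod (n + 1)" if "k div (n + 1) = l div (n + 1)"
    using div_mult_mod_eq[of k "n + 1"] div_mult_mod_eq[of l "n + 1"] that by (metis add_less_cancel_left)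
  moreover have "l < k" if "l div (n + 1) < k div (n + 1)" using that by (meson div_le_mono not_less)
  ultimately show ?thesis
    unfolding read_before_def box_at_def fst_conv snd_conv by (metis not_less_iff_gr_or_eq)
qed

lemma box_at_surj:
  assumes "rows_bounded n T" "T p \<noteq> None"
  obtains k where "p = box_at n k"
  using assms box_at_reading_position[of p n] unfolding rows_bounded_def
  by (metis atLeastAtMost_iff prod.collapse)

lemma cancelled_pairD:
  assumes "cancelled_pair T i p q"
  shows "T p = Some i" "T q = Some (i + 1)" "p \<prec> q"
  using assms by (cases, simp)+

text \<open>
  An inductively defined cancelled pair need not be balanced by definition, but it cannot contain more
  plus signs than minus signs: going backwards from the minus, every plus that is met is compensated
  by the part up to its partner.
\<close>

lemma balance_cancelled_pair:
  assumes rows: "rows_bounded n T" and "cancelled_pair T i p q"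
  shows "balance n i T (Suc (reading_position n q)) \<le> balance n i T (reading_position n p)"
  using assms(2)
proof (induction rule: cancelled_pair.induct)
  case (1 p q)
  let ?H = "balance n i T"
  obtain k where k: "p = box_at n k" using box_at_surj[OF rows] 1(1) by blast
  obtain l where l: "q = box_at n l" using box_at_surj[OF rows] 1(2) by blast
  have kl: "k < l" using 1(3) by (simp add: k l read_before_box_at)
  have "?H l \<le> ?H x" if "x \<le> l" "k < x" for x
    using that
  proof (induction "l - x" arbitrary: x rule: less_induct)
    case less
    show ?case
    proof (cases "x < l")
      case True
      then have step: "?H l \<le> ?H (Suc x)" using less by auto
      show ?thesis
      proof (cases "T (box_at n x) = Some i")
        case plus: True
        then obtain s where s: "p \<prec> s" "s \<prec> q"
          "cancelled_pair T i (box_at n x) s \<and>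
             ?H (Suc (reading_position n s)) \<le> ?H (reading_position n (box_at n x))
           \<or> cancelled_pair T i s (box_at n x)"
          using 1(4)[rule_format, of "box_at n x"] True less.prems by (auto simp: k l read_before_box_at)
        have "\<not> cancelled_pair T i s (box_at n x)"
          using plus cancelled_pairD(2) by fastforce
        then have c: "cancelled_pair T i (box_at n x) s" "?H (Suc (reading_position n s)) \<le> ?H x"
          using s(3) by (auto simp: reading_position_box_at)
        then obtain y where y: "s = box_at n y"
          using box_at_surj[OF rows, of s] cancelled_pairD(2)[OF c(1)] by auto
        have "x < y" using cancelled_pairD(3)[OF c(1)] by (simp add: y read_before_box_at)
        moreover have "y < l" using s(2) by (simp add: y l read_before_box_at)
        ultimately have "?H l \<le> ?H (Suc y)" using less by auto
        then show ?thesis using c(2) by (simp add: y reading_position_box_at)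
      qed (use step in \<open>auto simp: balance_Suc sign_def split: if_splits\<close>)
    qed (use less.prems in auto)
  qed
  from this[of "Suc k"] show ?case
    using kl 1(1,2) by (simp add: k l reading_position_box_at balance_Suc sign_def)
qed

text \<open>
  The blocks that matching of parentheses would find: the balance first returns at the end.
\<close>

definition balanced_block :: "nat \<Rightarrow> nat \<Rightarrow> tableau \<Rightarrow> nat \<Rightarrow> nat \<Rightarrow> bool" where
  "balanced_block n i T k l \<longleftrightarrow> k < l \<and> balance n i T (Suc l) = balance n i T k \<and>
     (\<forall>x. k < x \<and> x \<le> l \<longrightarrow> balance n i T k < balance n i T x)"

lemma balanced_block_signs:
  assumes "balanced_block n i T k l"
  shows "T (box_at n k) = Some i" "T (box_at n l) = Some (i + 1)"
proof -
  have "balance n i T k < balance n i T (Suc k)" "balance n i T k < balance n i T l"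
    "balance n i T (Suc l) = balance n i T k"
    using assms by (auto simp: balanced_block_def)
  then show "T (box_at n k) = Some i" "T (box_at n l) = Some (i + 1)"
    by (auto simp: balance_Suc sign_def split: if_splits)
qed

text \<open>
  The block ends where the balance returns to its old value for the first time.
\<close>

lemma plus_starts_block:
  assumes "T (box_at n x) = Some i" "x < l" "balance n i T l \<le> balance n i T x"
  shows "\<exists>y. y < l \<and> balanced_block n i T x y"
proof -
  let ?H = "balance n i T"
  let ?P = "\<lambda>y. x \<le> y \<and> ?H (Suc y) \<le> ?H x"
  define y where "y = (LEAST y. ?P y)"
  have "?P (l - 1)" using assms by auto
  then have y: "?P y" "y \<le> l - 1" unfolding y_def by (rule LeastI, rule Least_le)
  have up: "?H (Suc x) = ?H x + 1" using assms(1) by (simp add: balance_Suc sign_def)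
  then have xy: "x < y" using y(1) by (cases "x = y") auto
  have gt: "?H x < ?H z" if "x < z" "z \<le> y" for z
    using not_less_Least[of "z - 1" ?P, folded y_def] that by (cases z) auto
  then have "?H x < ?H y" using xy by simp
  moreover have "?H y \<le> ?H (Suc y) + 1" by (auto simp: balance_Suc sign_def)
  ultimately have "?H (Suc y) = ?H x" using y(1) by linarith
  then have "balanced_block n i T x y" using xy gt by (auto simp: balanced_block_def)
  then show ?thesis using y(2) assms(2) by (intro exI[of _ y]) auto
qed

text \<open>
  The block starts at the last position whose balance is not above the balance after the minus.
\<close>

lemma minus_ends_block:
  assumes "T (box_at n x) = Some (i + 1)" "k \<le> x" "balance n i T k \<le> balance n i T (Suc x)"
  shows "\<exists>y. k \<le> y \<and> balanced_block n i T y x"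
proof -
  let ?H = "balance n i T"
  let ?P = "\<lambda>y. y \<le> x \<and> ?H y \<le> ?H (Suc x)"
  define y where "y = (GREATEST y. ?P y)"
  have k: "?P k" using assms by auto
  have y: "?P y" "k \<le> y" unfolding y_def
    using GreatestI_nat[where P = ?P, of k x] Greatest_le_nat[where P = ?P, of k x] k by blast+
  have up: "?H (Suc x) = ?H x - 1" using assms(1) by (simp add: balance_Suc sign_def)
  then have xy: "y < x" using y(1) by (cases "x = y") auto
  have gt: "?H (Suc x) < ?H z" if "y < z" "z \<le> x" for z
  proof (rule ccontr)
    assume "\<not> ?thesis"
    then have "?P z" using that by simp
    then have "z \<le> y" unfolding y_def using Greatest_le_nat[where P = ?P, of z x] by blast
    then show False using that by simp
  qed
  have "?H (Suc x) < ?H (Suc y)" using gt xy by simp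
  moreover have "?H (Suc y) \<le> ?H y + 1" by (auto simp: balance_Suc sign_def)
  ultimately have "?H (Suc x) = ?H y" using y(1) by linarith
  then have "balanced_block n i T y x" using xy gt by (auto simp: balanced_block_def)
  then show ?thesis using y(2) by blast
qed

text \<open>
  Every sign inside a block belongs to a smaller block inside, by the two preceding lemmas.
\<close>

lemma balanced_block_cancelled_pair:
  assumes rows: "rows_bounded n T"
  shows "balanced_block n i T k l \<Longrightarrow> cancelled_pair T i (box_at n k) (box_at n l)"
proof (induction "l - k" arbitrary: k l rule: less_induct)
  case less
  let ?H = "balance n i T"
  have kl: "k < l" and bal: "?H (Suc l) = ?H k" and pos: "\<And>x. k < x \<Longrightarrow> x \<le> l \<Longrightarrow> ?H k < ?H x"
    using less.prems by (auto simp: balanced_block_def)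
  note sg = balanced_block_signs[OF less.prems]
  show ?case
  proof (rule cancelled_pair.intros[OF sg], use kl in \<open>simp add: read_before_box_at\<close>, intro allI impI)
    fix r assume r: "box_at n k \<prec> r \<and> r \<prec> box_at n l \<and> T r \<in> {Some i, Some (i + 1)}"
    then obtain x where x: "r = box_at n x" using box_at_surj[OF rows] by blast
    have kxl: "k < x" "x < l" using r by (auto simp: x read_before_box_at)
    show "\<exists>s. box_at n k \<prec> s \<and> s \<prec> box_at n l \<and> (cancelled_pair T i r s \<or> cancelled_pair T i s r)"
    proof (cases "T r = Some i")
      case True
      have "?H l \<le> ?H x" using pos[OF kxl(1)] kxl bal sg by (auto simp: balance_Suc sign_def)
      then obtain y where y: "y < l" "balanced_block n i T x y"
        using plus_starts_block True kxl unfolding x by blast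
      then have "cancelled_pair T i r (box_at n y)"
        unfolding x using kxl by (intro less.hyps) auto
      moreover have "x < y" using y(2) by (simp add: balanced_block_def)
      ultimately show ?thesis using y(1) kxl by (intro exI[of _ "box_at n y"]) (auto simp: read_before_box_at)
    next
      case False
      then have m: "T (box_at n x) = Some (i + 1)" using r x by auto
      have "?H (Suc k) \<le> ?H (Suc x)" using pos[of "Suc x"] kxl sg by (auto simp: balance_Suc[of n i T k] sign_def)
      then obtain y where y: "Suc k \<le> y" "balanced_block n i T y x"
        using minus_ends_block[of T n x i "Suc k", OF m] kxl by auto
      have "y < x" using y(2) by (simp add: balanced_block_def)
      moreover have "cancelled_pair T i (box_at n y) r"
        unfolding x using kxl y \<open>y < x\<close> by (intro less.hyps) auto
      ultimately show ?thesis using y(1) kxl by (intro exI[of _ "box_at n y"]) (auto simp: read_before_box_at)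
    qed
  qed
qed

text \<open>
  A plus that cancels is the start of a stretch at whose end the balance is not higher. This is
  impossible at the last minimum of the balance, and it happens for every earlier plus.
\<close>

lemma leftmost_plus_last_minimum:
  assumes rows: "rows_bounded n T"
    and min: "\<And>x. balance n i T k \<le> balance n i T x" "\<And>x. k < x \<Longrightarrow> balance n i T k < balance n i T x"
  shows "leftmost_plus T i = box_at n k"
proof -
  let ?H = "balance n i T"
  have "?H k < ?H (Suc k)" using min by simp
  then have Tk: "T (box_at n k) = Some i" by (auto simp: balance_Suc sign_def split: if_splits)
  have sk: "signature_plus T i (box_at n k)"
    unfolding signature_plus_def
  proof (intro conjI Tk notI)
    assume "\<exists>q. cancelled_pair T i (box_at n k) q"
    then obtain q where q: "cancelled_pair T i (box_at n k) q" by blast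
    then obtain l where l: "q = box_at n l"
      using box_at_surj[OF rows, of q] cancelled_pairD(2)[OF q] by auto
    have "k < l" using cancelled_pairD(3)[OF q] by (simp add: l read_before_box_at)
    moreover have "?H (Suc l) \<le> ?H k"
      using balance_cancelled_pair[OF rows q] by (simp add: l reading_position_box_at)
    ultimately show False using min(2)[of "Suc l"] by simp
  qed
  have first: "box_at n k \<prec> q" if q: "signature_plus T i q" "q \<noteq> box_at n k" for q
  proof (rule ccontr)
    assume *: "\<not> ?thesis"
    have Tq: "T q = Some i" using q by (simp add: signature_plus_def)
    then obtain x where x: "q = box_at n x" using box_at_surj[OF rows] by blast
    have "x < k" using * q(2) by (auto simp: x read_before_box_at not_less order_le_less)
    then obtain y where "balanced_block n i T x y"
      using plus_starts_block[of T n x i k] min(1) Tq x by blast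
    then have "cancelled_pair T i (box_at n x) (box_at n y)" by (rule balanced_block_cancelled_pair[OF rows])
    then show False using q(1) unfolding x signature_plus_def by blast
  qed
  show ?thesis unfolding leftmost_plus_def
  proof (rule the_equality)
    show "signature_plus T i (box_at n k) \<and> (\<forall>q. signature_plus T i q \<and> q \<noteq> box_at n k \<longrightarrow> box_at n k \<prec> q)"
      using sk first by blast
    show "p = box_at n k"
      if "signature_plus T i p \<and> (\<forall>q. signature_plus T i q \<and> q \<noteq> p \<longrightarrow> p \<prec> q)" for p
    proof (rule ccontr)
      assume "p \<noteq> box_at n k"
      then have "box_at n k \<prec> p" "p \<prec> box_at n k" using that sk first[of p] by metis+
      then show False by (auto simp: read_before_def)
    qed
  qed
qed

section \<open>The tableau of a multisegment\<close>

text \<open>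
  The number of boxes in row \<open>j\<close> whose entry exceeds \<open>e\<close>, for \<open>e \<ge> j\<close>.
\<close>

definition boxes_above :: "nat \<Rightarrow> multisegment \<Rightarrow> nat \<Rightarrow> nat \<Rightarrow> int" where
  "boxes_above n m j e = (\<Sum>b = e..n. m j b)"

text \<open>
  The column of the right end of row \<open>j\<close>. Marginal largeness forces row \<open>k + 1\<close> to end one column to
  the left of the rightmost \<open>k\<close>-box of row \<open>k\<close>, whence the \<open>+ 1\<close>.
\<close>

definition row_start :: "nat \<Rightarrow> multisegment \<Rightarrow> nat \<Rightarrow> int" where
  "row_start n m j = (\<Sum>k = 1..<j. boxes_above n m k k + 1)"

text \<open>
  Row \<open>j\<close> lists its entries weakly decreasing from right to left, starting in column \<open>row_start n m j\<close>;
  the entry in column \<open>c\<close> is the least \<open>e\<close> such that all larger entries are placed before \<open>c\<close>.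
\<close>

definition tableau_of :: "nat \<Rightarrow> multisegment \<Rightarrow> tableau" where
  "tableau_of n m = (\<lambda>(j, c).
     if j \<in> {1..n} \<and> row_start n m j \<le> int c
     then Some (LEAST e. j \<le> e \<and> row_start n m j + boxes_above n m j e \<le> int c) else None)"

lemma boxes_above_nonneg: "m \<in> multisegments n \<Longrightarrow> 0 \<le> boxes_above n m j e"
  by (auto simp: boxes_above_def multisegments_def intro: sum_nonneg)

lemma boxes_above_Suc: "e \<le> n \<Longrightarrow> boxes_above n m j e = m j e + boxes_above n m j (Suc e)"
  by (simp add: boxes_above_def sum.atLeast_Suc_atMost)

lemma boxes_above_top: "n < e \<Longrightarrow> boxes_above n m j e = 0"
  by (simp add: boxes_above_def)

lemma boxes_above_antimono:
  assumes "m \<in> multisegments n" "e \<le> e'"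
  shows "boxes_above n m j e' \<le> boxes_above n m j e"
  unfolding boxes_above_def by (rule sum_mono2) (use assms in \<open>auto simp: multisegments_def\<close>)

lemma row_start_Suc: "1 \<le> j \<Longrightarrow> row_start n m (Suc j) = row_start n m j + boxes_above n m j j + 1"
  by (simp add: row_start_def)

lemma row_start_strict_mono:
  assumes "m \<in> multisegments n" "1 \<le> j" "j < k"
  shows "row_start n m j + boxes_above n m j j < row_start n m k"
  using assms(3)
proof (induction k)
  case (Suc k)
  show ?case
  proof (cases "j = k")
    case True
    then show ?thesis using assms(2) row_start_Suc[of k n m] by simp
  next
    case False
    then have "row_start n m j + boxes_above n m j j < row_start n m k" "1 \<le> k" using Suc assms(2) by auto
    then show ?thesis using row_start_Suc[of k n m] boxes_above_nonneg[OF assms(1), of k k] by simp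
  qed
qed simp

lemma row_start_nonneg: "m \<in> multisegments n \<Longrightarrow> 0 \<le> row_start n m j"
  unfolding row_start_def by (intro sum_nonneg add_nonneg_nonneg boxes_above_nonneg) auto

lemma tableau_of_eq_Some:
  assumes m: "m \<in> multisegments n" and j: "j \<in> {1..n}"
  shows "tableau_of n m (j, c) = Some e \<longleftrightarrow>
    j \<le> e \<and> row_start n m j + boxes_above n m j e \<le> int c \<and>
    (e = j \<or> int c < row_start n m j + boxes_above n m j (e - 1))"
    (is "?l \<longleftrightarrow> ?r")
proof
  let ?P = "\<lambda>e. j \<le> e \<and> row_start n m j + boxes_above n m j e \<le> int c"
  assume ?l
  then have c: "row_start n m j \<le> int c" and e: "e = (LEAST e. ?P e)"
    by (auto simp: tableau_of_def split: if_splits)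
  have "?P (n + 1)" using c j by (simp add: boxes_above_top)
  then have P: "?P e" unfolding e by (rule LeastI)
  moreover have "\<not> ?P (e - 1)" if "e \<noteq> j"
    unfolding e by (rule not_less_Least) (use that P e in linarith)
  moreover have "j \<le> e - 1" if "e \<noteq> j" using P that by linarith
  ultimately show ?r by (cases "e = j") (auto simp: not_le)
next
  let ?P = "\<lambda>e. j \<le> e \<and> row_start n m j + boxes_above n m j e \<le> int c"
  assume r: ?r
  have "(LEAST e. ?P e) = e"
  proof (rule Least_equality)
    show "?P e" using r by blast
    show "e \<le> e'" if "?P e'" for e'
    proof (rule ccontr)
      assume "\<not> ?thesis"
      then have "e' \<le> e - 1" "e \<noteq> j" using that by auto
      then have "boxes_above n m j (e - 1) \<le> boxes_above n m j e'" using boxes_above_antimono[OF m] by blast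
      then show False using r that \<open>e \<noteq> j\<close> by linarith
    qed
  qed
  moreover have "row_start n m j \<le> int c" using r boxes_above_nonneg[OF m, of j e] by linarith
  ultimately show ?l using j by (simp add: tableau_of_def)
qed

lemma tableau_of_eq_None:
  "tableau_of n m (j, c) = None \<longleftrightarrow> \<not> (j \<in> {1..n} \<and> row_start n m j \<le> int c)"
  by (simp add: tableau_of_def)

lemma tableau_of_le:
  assumes "m \<in> multisegments n" "tableau_of n m (j, c) = Some e"
  shows "j \<le> e" "e \<le> n + 1" "j \<in> {1..n}"
proof -
  show j: "j \<in> {1..n}" using assms(2) tableau_of_eq_None[of n m j c] by fastforce
  note * = tableau_of_eq_Some[OF assms(1) j, of c e]
  show "j \<le> e" using * assms(2) by simp
  show "e \<le> n + 1"
  proof (rule ccontr)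
    assume "\<not> ?thesis"
    then have "boxes_above n m j e = 0" "boxes_above n m j (e - 1) = 0" "e \<noteq> j"
      using j by (auto intro: boxes_above_top)
    then show False using * assms(2) by linarith
  qed
qed

text \<open>
  This recovers \<open>m\<close> from its tableau, so that distinct multisegments have distinct tableaux.
\<close>

lemma num_boxes_tableau_of:
  assumes m: "m \<in> multisegments n" and "1 \<le> j" "j < i" "i \<le> n + 1"
  shows "int (num_boxes (tableau_of n m) j i) = m j (i - 1)"
proof -
  let ?A = "row_start n m j + boxes_above n m j i"
  have j: "j \<in> {1..n}" using assms by simp
  have B: "row_start n m j + boxes_above n m j (i - 1) = ?A + m j (i - 1)"
    using assms boxes_above_Suc[of "i - 1" n m j] by simp
  have nn: "0 \<le> ?A" "0 \<le> m j (i - 1)"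
    using row_start_nonneg[OF m] boxes_above_nonneg[OF m] m by (auto simp: multisegments_def)
  have "{c. tableau_of n m (j, c) = Some i} = {nat ?A..<nat (?A + m j (i - 1))}"
    using assms nn unfolding tableau_of_eq_Some[OF m j] B by (auto simp: nat_le_iff zless_nat_eq_int_zless)
  then show ?thesis using nn by (simp add: num_boxes_def nat_diff_distrib[symmetric])
qed

lemma tableau_of_inj: "inj_on (tableau_of n) (multisegments n)"
proof (rule inj_onI, intro ext)
  fix m m' a b assume m: "m \<in> multisegments n" "m' \<in> multisegments n" "tableau_of n m = tableau_of n m'"
  show "m a b = m' a b"
  proof (cases "1 \<le> a \<and> a \<le> b \<and> b \<le> n")
    case True
    then show ?thesis
      using num_boxes_tableau_of[OF m(1), of a "b + 1"] num_boxes_tableau_of[OF m(2), of a "b + 1"] m(3) by simp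
  next
    case False
    then have "m a b = 0" "m' a b = 0" using m by (auto simp: multisegments_def)
    then show ?thesis by simp
  qed
qed

lemma tableau_of_antimono:
  assumes m: "m \<in> multisegments n"
    and "c \<le> c'" "tableau_of n m (j, c) = Some e" "tableau_of n m (j, c') = Some e'"
  shows "e' \<le> e"
proof (rule ccontr)
  assume "\<not> ?thesis"
  then have lt: "e \<le> e' - 1" "e < e'" by auto
  have j: "j \<in> {1..n}" using tableau_of_le[OF m assms(3)] by simp
  note eq = tableau_of_eq_Some[OF m j]
  have "j \<le> e" "row_start n m j + boxes_above n m j e \<le> int c" using assms(3) eq by auto
  moreover have "int c' < row_start n m j + boxes_above n m j (e' - 1)"
    using assms(4) eq lt \<open>j \<le> e\<close> by auto
  ultimately show False using boxes_above_antimono[OF m lt(1), of j] assms(2) by linarith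
qed

lemma count_list_eq_card: "count_list xs a = card {k. k < length xs \<and> xs ! k = a}"
  by (simp add: count_list_eq_length_filter length_filter_conv_card eq_commute)

text \<open>
  The finite tableau is cut off after \<open>row_start n m (n + 1)\<close> columns, the position at which row
  \<open>n + 1\<close> would end. This keeps exactly one \<open>n\<close>-box in row \<open>n\<close>, as marginal largeness requires there.
\<close>

lemma tableau_of_in_MLT:
  assumes m: "m \<in> multisegments n" and n: "1 \<le> n"
  shows "tableau_of n m \<in> MLT n"
proof -
  let ?T = "tableau_of n m"
  let ?R = "\<lambda>j. nat (row_start n m j)"
  define L where "L = ?R (n + 1)"
  define r where "r j = map (\<lambda>k. the (?T (j, L - 1 - k))) [0..<L - ?R j]" for j
  define t where "t = map r [1..<n + 1]"
  have nn: "0 \<le> row_start n m j" for j by (rule row_start_nonneg[OF m])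
  have R_mono: "?R j < ?R k" if "1 \<le> j" "j < k" for j k
    using row_start_strict_mono[OF m that] boxes_above_nonneg[OF m, of j j] nn[of j] by linarith
  have row_t: "row t j = r j" if "j \<in> {1..n + 1}" for j
  proof (cases "j = n + 1")
    case True
    then show ?thesis by (simp add: row_def t_def r_def L_def)
  next
    case False
    then show ?thesis using that by (auto simp: row_def t_def simp del: upt_Suc)
  qed
  have len: "length (r j) = L - ?R j" for j by (simp add: r_def)
  have R1: "?R 1 = 0" by (simp add: row_start_def)
  have entry: "?T (j, L - 1 - k) = Some (r j ! k)" if "j \<in> {1..n}" "k < L - ?R j" for j k
  proof -
    have "?R j \<le> L - 1 - k" using that by linarith
    then have "row_start n m j \<le> int (L - 1 - k)" by linarith
    then have "?T (j, L - 1 - k) \<noteq> None" using that(1) by (simp add: tableau_of_eq_None)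
    then show ?thesis using that(2) by (auto simp: r_def)
  qed
  have diag: "r i ! k = i \<longleftrightarrow> k < L - ?R (i + 1) + 1" if "i \<in> {1..n}" "k < L - ?R i" for i k
  proof -
    have "r i ! k = i \<longleftrightarrow> row_start n m i + boxes_above n m i i \<le> int (L - 1 - k)"
      using tableau_of_eq_Some[OF m that(1), of "L - 1 - k" i] entry[OF that] by auto
    also have "\<dots> \<longleftrightarrow> row_start n m (i + 1) \<le> int (L - 1 - k) + 1"
      using row_start_Suc[of i n m] that(1) by auto
    also have "\<dots> \<longleftrightarrow> k < L - ?R (i + 1) + 1"
    proof -
      have "?R (i + 1) \<le> L" using R_mono[of "i + 1" "n + 1"] that(1) by (cases "i = n") (auto simp: L_def)
      then show ?thesis using that(2) nn[of "i + 1"] by linarith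
    qed
    finally show ?thesis .
  qed
  have ge: "j \<le> r j ! k" "r j ! k \<le> n + 1" if "j \<in> {1..n}" "k < L - ?R j" for j k
    using tableau_of_le[OF m entry[OF that]] by auto
  have pos: "0 < L - ?R j" if "j \<in> {1..n}" for j
    using R_mono[of j "n + 1"] that by (auto simp: L_def)
  have srt: "sorted (r j)" if "j \<in> {1..n}" for j
    unfolding sorted_iff_nth_mono len
  proof (intro allI impI)
    fix k k' assume "k \<le> k'" "k' < L - ?R j"
    then show "r j ! k \<le> r j ! k'"
      using tableau_of_antimono[OF m _ entry[OF that, of k'] entry[OF that, of k]] by auto
  qed
  have "semistandard n t"
    unfolding semistandard_def
  proof (intro conjI ballI allI impI)
    show "length t = n" by (simp add: t_def)
    fix l assume "l \<in> set t"
    then have "l \<in> r ` {1..n}" by (simp add: t_def atLeastLessThanSuc_atLeastAtMost del: upt_Suc)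
    then obtain j where j: "j \<in> {1..n}" "l = r j" by blast
    show "l \<noteq> []" using pos[OF j(1)] len[of j] j(2) by auto
    show "sorted l" using srt j by simp
    show "set l \<subseteq> {1..n + 1}"
    proof
      fix x assume "x \<in> set l"
      then obtain k where "k < L - ?R j" "x = r j ! k" by (auto simp: j(2) in_set_conv_nth len)
      then show "x \<in> {1..n + 1}" using ge[OF j(1), of k] j(1) by auto
    qed
  next
    fix i assume i: "i \<in> {1..<n}"
    then have rows: "row t i = r i" "row t (i + 1) = r (i + 1)" "?R i < ?R (i + 1)"
      using row_t[of i] row_t[of "i + 1"] R_mono[of i "i + 1"] by auto
    show "length (row t (i + 1)) \<le> length (row t i)" unfolding rows(1,2) len by (intro diff_le_mono2 less_imp_le rows(3))
    fix k assume "k < length (row t (i + 1))"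
    then have k: "k < L - ?R (i + 1)" "k < L - ?R i" unfolding rows(1,2) len using rows(3) by linarith+
    have "r i ! k = i" using diag[of i k] i k by auto
    then show "row t i ! k < row t (i + 1) ! k" unfolding rows(1,2) using ge(1)[of "i + 1" k] i k by auto
  qed
  moreover have "count_list (row t i) i = length (row t (i + 1)) + 1" if i: "i \<in> {1..n}" for i
  proof -
    have "?R i < ?R (i + 1)" "?R (i + 1) \<le> L"
      using R_mono[of i "i + 1"] R_mono[of "i + 1" "n + 1"] i by (auto simp: L_def le_less)
    then have le: "L - ?R (i + 1) + 1 \<le> L - ?R i" by linarith
    then have "{k. k < length (r i) \<and> r i ! k = i} = {..<L - ?R (i + 1) + 1}"
      using diag[OF i] unfolding len by fastforce
    moreover have "row t i = r i" "row t (i + 1) = r (i + 1)" using i by (auto intro!: row_t)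
    ultimately show ?thesis by (simp add: count_list_eq_card len)
  qed
  ultimately have "marginally_large n t" by (simp add: marginally_large_def)
  moreover have "mlt_of n t = ?T"
  proof (rule ext, clarify)
    fix j c
    have l1: "length (row t 1) = L" using row_t[of 1] R1 len[of 1] by simp
    show "mlt_of n t (j, c) = ?T (j, c)"
    proof (cases "j \<in> {1..n}")
      case j: True
      have RL: "?R j < L" using pos[OF j] by simp
      show ?thesis
      proof (cases "c < L")
        case True
        have "L - c \<le> L - ?R j \<longleftrightarrow> ?R j \<le> c" using True RL by linarith
        then show ?thesis
          using entry[OF j, of "L - c - 1"] True j row_t[of j] l1 tableau_of_eq_None[of n m j c] nn[of j]
          by (cases "?R j \<le> c") (auto simp: mlt_of_def len)
      next
        case False
        have "row_start n m j + boxes_above n m j j < row_start n m (n + 1)"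
          using row_start_strict_mono[OF m, of j "n + 1"] j by auto
        then have "?T (j, c) = Some j"
          using False unfolding L_def by (subst tableau_of_eq_Some[OF m j]) auto
        then show ?thesis using False j l1 by (simp add: mlt_of_def)
      qed
    qed (auto simp: mlt_of_def tableau_of_def)
  qed
  ultimately show ?thesis unfolding MLT_def by (metis image_eqI mem_Collect_eq)
qed

lemma sum_count_list:
  fixes xs :: "nat list"
  assumes "set xs \<subseteq> {..n + 1}"
  shows "(\<Sum>b = e..n. count_list xs (b + 1)) = length (filter (\<lambda>x. e < x) xs)"
  using assms
proof (induction xs)
  case (Cons x xs)
  have "(\<Sum>b = e..n. if x = b + 1 then 1 else 0) = (\<Sum>b = e..n. if b = x - 1 then (if 0 < x then 1 else 0) else 0)"
    by (intro sum.cong) auto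
  also have "\<dots> = (if e < x then 1 else 0 :: nat)" using Cons.prems by (auto simp: sum.delta)
  finally have "(\<Sum>b = e..n. if x = b + 1 then 1 else 0) = (if e < x then 1 else 0 :: nat)" .
  moreover have "(\<Sum>b = e..n. count_list (x # xs) (b + 1))
     = (\<Sum>b = e..n. count_list xs (b + 1)) + (\<Sum>b = e..n. if x = b + 1 then 1 else 0)"
    by (subst sum.distrib[symmetric], rule sum.cong) auto
  ultimately show ?case using Cons by simp
qed simp

lemma sorted_nth_le_iff:
  fixes xs :: "nat list"
  assumes "sorted xs" "k < length xs"
  shows "xs ! k \<le> e \<longleftrightarrow> k + length (filter (\<lambda>x. e < x) xs) < length xs"
  using assms
proof (induction xs arbitrary: k)
  case (Cons x xs)
  show ?case
  proof (cases "x \<le> e")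
    case True
    then show ?thesis using Cons by (cases k) (auto simp: le_imp_less_Suc)
  next
    case False
    then have "filter (\<lambda>x. e < x) xs = xs" using Cons.prems by (auto simp: filter_id_conv)
    moreover have "\<not> (x # xs) ! k \<le> e" using False Cons.prems by (cases k) (auto simp: not_le intro: less_le_trans)
    ultimately show ?thesis using False by simp
  qed
qed simp

text \<open>
  Marginal largeness determines the lengths of the rows successively from the numbers of boxes, and a
  sorted row is determined by these numbers.
\<close>

lemma MLT_imp_tableau_of:
  assumes n: "1 \<le> n" and T: "T \<in> MLT n"
  shows "\<exists>m\<in>multisegments n. T = tableau_of n m"
proof -
  obtain t where ml: "marginally_large n t" and T: "T = mlt_of n t" using T by (auto simp: MLT_def)
  define m where "m a b = (if 1 \<le> a \<and> a \<le> b \<and> b \<le> n then int (count_list (row t a) (b + 1)) else 0)" for a b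
  have m: "m \<in> multisegments n" by (auto simp: m_def multisegments_def)
  let ?len = "\<lambda>j. length (row t j)"
  have ss: "semistandard n t" and cnt: "\<And>i. i \<in> {1..n} \<Longrightarrow> count_list (row t i) i = ?len (i + 1) + 1"
    using ml by (auto simp: marginally_large_def)
  have rowin: "row t j \<in> set t" if "j \<in> {1..n}" for j
    using that ss by (auto simp: row_def semistandard_def)
  have srt: "sorted (row t j)" and ent: "set (row t j) \<subseteq> {1..n + 1}" if "j \<in> {1..n}" for j
    using rowin[OF that] ss by (auto simp: semistandard_def)
  have last: "?len (n + 1) = 0" using ss by (simp add: row_def semistandard_def)
  have ge: "j \<le> row t j ! k" if "j \<in> {1..n}" "k < ?len j" for j k
    using that
  proof (induction j)
    case (Suc j)
    show ?case
    proof (cases "j = 0")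
      case True
      then show ?thesis using ent[OF Suc.prems(1)] nth_mem[OF Suc.prems(2)] by auto
    next
      case False
      then have "row t j ! k < row t (Suc j) ! k" "k < ?len j"
        using ss Suc.prems by (fastforce simp: semistandard_def)+
      then show ?thesis using Suc False by fastforce
    qed
  qed simp
  have B: "boxes_above n m j e = int (length (filter (\<lambda>x. e < x) (row t j)))" if "j \<in> {1..n}" "j \<le> e" for j e
  proof -
    have "boxes_above n m j e = (\<Sum>b = e..n. int (count_list (row t j) (b + 1)))"
      unfolding boxes_above_def using that by (intro sum.cong) (auto simp: m_def)
    also have "\<dots> = int (length (filter (\<lambda>x. e < x) (row t j)))"
      unfolding of_nat_sum[symmetric] using ent[OF that(1)] by (subst sum_count_list) auto
    finally show ?thesis .
  qed
  have Bdiag: "boxes_above n m j j + int (?len (j + 1)) + 1 = int (?len j)" if j: "j \<in> {1..n}" for j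
  proof -
    have "filter (\<lambda>x. \<not> j < x) (row t j) = filter (\<lambda>x. j = x) (row t j)"
    proof (rule filter_cong[OF refl])
      fix x assume "x \<in> set (row t j)"
      then have "j \<le> x" using ge[OF j] by (auto simp: in_set_conv_nth)
      then show "(\<not> j < x) = (j = x)" by auto
    qed
    then have "length (filter (\<lambda>x. \<not> j < x) (row t j)) = ?len (j + 1) + 1"
      using cnt[OF j] by (simp add: count_list_eq_length_filter)
    then show ?thesis using B[OF j order_refl] sum_length_filter_compl[of "\<lambda>x. j < x" "row t j"] by linarith
  qed
  have R: "row_start n m j + int (?len j) = int (?len 1)" if "1 \<le> j" "j \<le> n + 1" for j
    using that
  proof (induction j rule: dec_induct)
    case base
    then show ?case by (simp add: row_start_def)
  next
    case (step j)
    then show ?case using row_start_Suc[of j n m] Bdiag[of j] by auto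
  qed
  have "T = tableau_of n m"
  proof (rule ext, clarify)
    fix j c
    show "T (j, c) = tableau_of n m (j, c)"
    proof (cases "j \<in> {1..n} \<and> ?len 1 - c \<le> ?len j")
      case True
      then have j: "j \<in> {1..n}" by simp
      have Rj: "row_start n m j + int (?len j) = int (?len 1)" using R j by auto
      show ?thesis
      proof (cases "c < ?len 1")
        case c: True
        define k where "k = ?len 1 - c - 1"
        have k: "k < ?len j" "int c = row_start n m j + int (?len j) - int k - 1"
          using c True Rj by (auto simp: k_def)
        let ?e = "row t j ! k"
        have iff: "row_start n m j + boxes_above n m j e \<le> int c \<longleftrightarrow> ?e \<le> e" if "j \<le> e" for e
          using sorted_nth_le_iff[OF srt[OF j] k(1), of e] B[OF j that] k(2) by linarith
        have "j \<le> ?e - 1 \<and> \<not> ?e \<le> ?e - 1" if "?e \<noteq> j" using ge[OF j k(1)] that by linarith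
        then have "tableau_of n m (j, c) = Some ?e"
          using iff[of ?e] iff[of "?e - 1"] ge[OF j k(1)] j
          by (cases "?e = j"; subst tableau_of_eq_Some[OF m j]) (auto simp: not_le)
        then show ?thesis using True c by (simp add: T mlt_of_def k_def)
      next
        case c: False
        have "row_start n m j + boxes_above n m j j \<le> int c"
          using Bdiag[OF j] Rj c by linarith
        then have "tableau_of n m (j, c) = Some j" by (subst tableau_of_eq_Some[OF m j]) auto
        then show ?thesis using True c by (simp add: T mlt_of_def)
      qed
    next
      case False
      then have "T (j, c) = None" by (auto simp: T mlt_of_def)
      moreover have "tableau_of n m (j, c) = None"
        using False R[of j] by (auto simp: tableau_of_eq_None)
      ultimately show ?thesis by simp
    qed
  qed
  then show ?thesis using m by blast
qed

lemma MLT_eq: "1 \<le> n \<Longrightarrow> MLT n = tableau_of n ` multisegments n"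
  using MLT_imp_tableau_of tableau_of_in_MLT by blast

section \<open>The leftmost plus of a tableau\<close>

lemma rows_bounded_tableau_of: "rows_bounded n (tableau_of n m)"
  using tableau_of_eq_None by (auto simp: rows_bounded_def)

text \<open>
  The number of reading positions below \<open>x\<close> that lie in row \<open>j\<close>.
\<close>

definition columns_read :: "nat \<Rightarrow> nat \<Rightarrow> nat \<Rightarrow> nat" where
  "columns_read n x j = (x + n - j) div (n + 1)"

lemma columns_read_Suc:
  assumes "j \<le> n"
  shows "columns_read n (Suc x) j = columns_read n x j + (if x mod (n + 1) = j then 1 else 0)"
proof -
  obtain q r where x: "x = q * (n + 1) + r" "r \<le> n"
    using div_mult_mod_eq[of x "n + 1"] mod_less_divisor[of "n + 1" x] by (metis Suc_eq_plus1 less_Suc_eq_le zero_less_Suc)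
  have r: "x mod (n + 1) = r" unfolding x(1) mod_mult_self3 using x(2) by simp
  have 1: "x + n - j = q * (n + 1) + (r + n - j)" "Suc x + n - j = q * (n + 1) + (r + n + 1 - j)"
    using assms unfolding x(1) by simp_all
  have "(r + n - j) div (n + 1) = (if j < r then 1 else 0)"
    using x(2) assms by (auto simp: div_nat_eqI)
  moreover have "(r + n + 1 - j) div (n + 1) = (if j \<le> r then 1 else 0)"
    using x(2) assms by (auto simp: div_nat_eqI)
  ultimately show ?thesis
    unfolding columns_read_def 1 r by (subst (1 2) div_mult_self3) auto
qed

lemma columns_read_antimono: "j \<le> k \<Longrightarrow> columns_read n x k \<le> columns_read n x j"
  unfolding columns_read_def by (rule div_le_mono) simp

definition row_balance :: "nat \<Rightarrow> tableau \<Rightarrow> nat \<Rightarrow> nat \<Rightarrow> int" where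
  "row_balance i T j k = (\<Sum>c<k. sign i (T (j, c)))"

text \<open>
  The reading goes by columns, but the signs can be summed row by row, provided that each row is
  stopped at its own last column.
\<close>

lemma balance_eq_row_balance:
  assumes "rows_bounded n T"
  shows "balance n i T x = (\<Sum>j = 1..n. row_balance i T j (columns_read n x j))"
proof (induction x)
  case 0
  have "columns_read n 0 j = 0" if "j \<in> {1..n}" for j using that by (simp add: columns_read_def)
  then show ?case by (simp add: balance_def row_balance_def)
next
  case (Suc x)
  have c: "columns_read n x (x mod (n + 1)) = x div (n + 1)"
  proof -
    have "x mod (n + 1) \<le> n" using mod_less_divisor[of "n + 1" x] by simp
    then have "x + n - x mod (n + 1) = x div (n + 1) * (n + 1) + n"
      using div_mult_mod_eq[of x "n + 1"] by linarith
    then show ?thesis unfolding columns_read_def by (simp only: div_mult_self3) simp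
  qed
  have *: "row_balance i T j (columns_read n (Suc x) j) = row_balance i T j (columns_read n x j)
      + (if j = x mod (n + 1) then sign i (T (box_at n x)) else 0)" if "j \<in> {1..n}" for j
    using that c unfolding columns_read_Suc[of j n x, OF that[unfolded atLeastAtMost_iff, THEN conjunct2]]
    by (auto simp: row_balance_def box_at_def)
  have "sign i (T (box_at n x)) = 0" if "x mod (n + 1) \<notin> {1..n}"
  proof -
    have "T (box_at n x) = None" using assms that unfolding rows_bounded_def box_at_def by blast
    then show ?thesis by (simp add: sign_def)
  qed
  then have "(\<Sum>j = 1..n. if j = x mod (n + 1) then sign i (T (box_at n x)) else 0) = sign i (T (box_at n x))"
    by (auto simp: sum.delta)
  moreover have "(\<Sum>j = 1..n. row_balance i T j (columns_read n (Suc x) j))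
      = (\<Sum>j = 1..n. row_balance i T j (columns_read n x j))
      + (\<Sum>j = 1..n. if j = x mod (n + 1) then sign i (T (box_at n x)) else 0)"
    using * by (simp add: sum.distrib)
  ultimately show ?case using Suc by (simp add: balance_Suc)
qed

lemma count_interval:
  fixes u v :: int
  assumes "0 \<le> u" "u \<le> v"
  shows "(\<Sum>c<k. if u \<le> int c \<and> int c < v then 1 else 0) = max 0 (min (int k) v - u)"
  by (induction k) (use assms in auto)

lemma count_from:
  fixes u :: int
  assumes "0 \<le> u"
  shows "(\<Sum>c<k. if u \<le> int c then 1 else 0) = max 0 (int k - u)"
  by (induction k) (use assms in auto)

text \<open>
  The signs of a row form at most two intervals of columns: minus signs followed by plus signs. The plus
  signs of row \<open>i\<close> and the minus signs of row \<open>i + 1\<close> go on forever.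
\<close>

lemma row_balance_tableau_of:
  assumes m: "m \<in> multisegments n" and j: "j \<in> {1..n}" and i: "i \<in> {1..n}"
  defines "R \<equiv> row_start n m j" and "B \<equiv> boxes_above n m j"
  shows "j < i \<Longrightarrow> row_balance i (tableau_of n m) j k
      = max 0 (min (int k) (R + B (i - 1)) - (R + B i)) - max 0 (min (int k) (R + B i) - (R + B (i + 1)))"
    and "j = i \<Longrightarrow> row_balance i (tableau_of n m) j k
      = max 0 (int k - (R + B i)) - max 0 (min (int k) (R + B i) - (R + B (i + 1)))"
    and "j = i + 1 \<Longrightarrow> row_balance i (tableau_of n m) j k = - max 0 (int k - (R + B j))"
    and "i + 1 < j \<Longrightarrow> row_balance i (tableau_of n m) j k = 0"
proof -
  note eq = tableau_of_eq_Some[OF m j, folded R_def B_def]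
  have nn: "0 \<le> R + B e" for e
    unfolding R_def B_def using row_start_nonneg[OF m] boxes_above_nonneg[OF m] by simp
  have mono: "R + B (i + 1) \<le> R + B i" "R + B i \<le> R + B (i - 1)"
    unfolding B_def using boxes_above_antimono[OF m] by simp_all
  show "row_balance i (tableau_of n m) j k
      = max 0 (min (int k) (R + B (i - 1)) - (R + B i)) - max 0 (min (int k) (R + B i) - (R + B (i + 1)))"
    if "j < i"
  proof -
    have "sign i (tableau_of n m (j, c)) = (if R + B i \<le> int c \<and> int c < R + B (i - 1) then 1 else 0)
        - (if R + B (i + 1) \<le> int c \<and> int c < R + B i then 1 else 0)" for c
      using that by (auto simp: sign_def eq)
    then show ?thesis using nn mono by (simp add: row_balance_def sum_subtractf count_interval)
  qed
  show "row_balance i (tableau_of n m) j k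
      = max 0 (int k - (R + B i)) - max 0 (min (int k) (R + B i) - (R + B (i + 1)))" if "j = i"
  proof -
    have "sign i (tableau_of n m (j, c)) = (if R + B i \<le> int c then 1 else 0)
        - (if R + B (i + 1) \<le> int c \<and> int c < R + B i then 1 else 0)" for c
      using eq[of c i] eq[of c "i + 1"] mono that by (auto simp: sign_def)
    then show ?thesis using nn mono by (simp add: row_balance_def sum_subtractf count_interval count_from)
  qed
  show "row_balance i (tableau_of n m) j k = - max 0 (int k - (R + B j))" if "j = i + 1"
  proof -
    have "sign i (tableau_of n m (j, c)) = - (if R + B j \<le> int c then 1 else 0)" for c
      using eq[of c i] eq[of c "i + 1"] that by (auto simp: sign_def)
    then show ?thesis using nn by (simp add: row_balance_def sum_negf count_from)
  qed
  show "row_balance i (tableau_of n m) j k = 0" if "i + 1 < j"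
    using that by (auto simp: row_balance_def sign_def eq)
qed

text \<open>
  The columns split into zones, one for each row \<open>z \<le> i\<close>, from the right end of row \<open>z\<close> to the right
  end of row \<open>z + 1\<close>. In zone \<open>z\<close> the signs of earlier rows have all been read and those of later rows
  not yet, so the balance is at least minus the height at \<open>z\<close>. It attains this value just before the
  plus signs of row \<open>z\<close>. The last zone has no end: there every minus in row \<open>i + 1\<close> is preceded by a
  plus in row \<open>i\<close>, with one plus in excess. So the last minimum of the balance lies in the zone of the
  last maximum of the height.
\<close>

lemma leftmost_plus_tableau_of:
  assumes m: "m \<in> multisegments n" and i: "i \<in> {1..n}"
  defines "a \<equiv> end_row m i"
  shows "leftmost_plus (tableau_of n m) i = (a, nat (row_start n m a + boxes_above n m a i))"
proof -
  let ?T = "tableau_of n m" and ?R = "row_start n m" and ?B = "boxes_above n m"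
  let ?K = "\<lambda>x j. int (columns_read n x j)"
  let ?rb = "\<lambda>x j. row_balance i ?T j (columns_read n x j)"
  have i1: "1 \<le> i" using i by simp
  note p = end_row_props[OF i1, where m = m, folded a_def]
  note rows = rows_bounded_tableau_of[of n m]
  note rb = row_balance_tableau_of[OF m _ i]
  have mnn: "0 \<le> m x y" for x y using m by (simp add: multisegments_def)
  have Bi: "?B z (i - 1) = m z (i - 1) + ?B z i" "?B z i = m z i + ?B z (i + 1)" for z
    using boxes_above_Suc[of "i - 1" n m z] boxes_above_Suc[of i n m z] i by auto
  have Bnn: "0 \<le> ?B z e" for z e by (rule boxes_above_nonneg[OF m])
  have Kmono: "?K x k \<le> ?K x j" if "j \<le> k" for x j k using columns_read_antimono[OF that] by simp
  define c0 where "c0 = nat (?R a + ?B a i)"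
  have c0: "int c0 = ?R a + ?B a i"
    using row_start_nonneg[OF m, of a] Bnn by (simp add: c0_def)
  define k0 where "k0 = reading_position n (a, c0)"
  have a: "a \<in> {1..n}" "a \<le> i" using p(1) i by auto
  have Ka: "columns_read n k0 a = c0" "columns_read n (Suc k0) a = Suc c0"
  proof -
    have "k0 + n - a = c0 * (n + 1) + n" "Suc k0 + n - a = c0 * (n + 1) + (n + 1)"
      using a by (simp_all add: k0_def reading_position_def)
    then show "columns_read n k0 a = c0" "columns_read n (Suc k0) a = Suc c0"
      unfolding columns_read_def by (simp_all only: div_mult_self3) simp_all
  qed

  define tail where "tail x z = (if z = i \<and> i < n then ?rb x (i + 1) else 0)" for x z
  \<comment> \<open>The value of the balance at position \<open>x\<close> in zone \<open>z\<close>;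
    \<open>tail\<close> is the contribution of row \<open>i + 1\<close>, which has begun only in
    the last zone.\<close>
  have formula: "balance n i ?T x = m z i - height m i z + ?rb x z + tail x z"
    if z: "z \<in> {1..i}" and reached: "z = 1 \<or> ?R z \<le> ?K x z" and ahead: "\<And>j. z < j \<Longrightarrow> j \<le> i \<Longrightarrow> ?K x j \<le> ?R j" for x z
  proof -
    have "{1..n} = {1..<z} \<union> ({z} \<union> {z<..n})" using z i by auto
    then have "(\<Sum>j = 1..n. ?rb x j) = (\<Sum>j = 1..<z. ?rb x j) + ((\<Sum>j\<in>{z}. ?rb x j) + (\<Sum>j\<in>{z<..n}. ?rb x j))"
      by (simp only:, subst sum.union_disjoint; (subst sum.union_disjoint)?) auto
    moreover have "(\<Sum>j = 1..<z. ?rb x j) = (\<Sum>j = 1..<z. m j (i - 1) - m j i)"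
    proof (rule sum.cong[OF refl])
      fix j assume j: "j \<in> {1..<z}"
      have "?R j + ?B j j < ?R z" using j by (intro row_start_strict_mono[OF m]) auto
      moreover have "?R z \<le> ?K x j" using reached j Kmono[of j z x] by auto
      moreover have "?B j (i - 1) \<le> ?B j j" using j z by (intro boxes_above_antimono[OF m]) auto
      moreover have "j < i" "j \<in> {1..n}" using j z i by auto
      ultimately show "?rb x j = m j (i - 1) - m j i"
        using Bi[of j] mnn[of j i] mnn[of j "i - 1"] by (simp add: rb(1))
    qed
    moreover have "(\<Sum>j = 1..<z. m j (i - 1) - m j i) = m z i - height m i z"
    proof -
      have "{1..z} = insert z {1..<z}" using z by auto
      then show ?thesis by (simp add: height_def sum_subtractf)
    qed
    moreover have "(\<Sum>j\<in>{z<..n}. ?rb x j) = tail x z"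
    proof -
      have zero: "?rb x j = 0" if "j \<in> {z<..n}" "\<not> (z = i \<and> j = i + 1)" for j
      proof -
        have j: "j \<in> {1..n}" using that z by auto
        consider "j < i" | "j = i" | "j = i + 1" | "i + 1 < j" by linarith
        then show ?thesis
        proof cases
          case 1
          then have "?K x j \<le> ?R j" using ahead that by auto
          then show ?thesis
            using rb(1)[OF j 1] Bnn[of j i] Bnn[of j "i - 1"] Bnn[of j "i + 1"] by (simp add: max_def min_def)
        next
          case 2
          then have "?K x j \<le> ?R j" using ahead that by auto
          then show ?thesis
            using rb(2)[OF j 2] 2 Bnn[of j i] Bnn[of j "i + 1"] by (simp add: max_def min_def)
        next
          case 3
          then have "?K x i \<le> ?R i" using ahead[of i] that z by auto
          moreover have "?R i + ?B i i < ?R j" using 3 i by (intro row_start_strict_mono[OF m]) auto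
          moreover have "?K x j \<le> ?K x i" using Kmono 3 by simp
          ultimately have "?K x j \<le> ?R j + ?B j j" using Bnn[of i i] Bnn[of j j] by linarith
          then show ?thesis using rb(3)[OF j 3] by simp
        next
          case 4
          then show ?thesis using rb(4)[OF j 4] by simp
        qed
      qed
      show ?thesis
      proof (cases "z = i \<and> i < n")
        case True
        then have "(\<Sum>j\<in>{z<..n}. ?rb x j) = (\<Sum>j\<in>{i + 1}. ?rb x j)"
          using zero by (intro sum.mono_neutral_right) auto
        then show ?thesis using True by (simp add: tail_def)
      next
        case False
        then have "(\<Sum>j\<in>{z<..n}. ?rb x j) = 0" using zero by (intro sum.neutral) auto
        then show ?thesis using False by (auto simp: tail_def)
      qed
    qed
    ultimately show ?thesis by (simp add: balance_eq_row_balance[OF rows])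
  qed
  have early: "0 \<le> m z i + ?rb x z + tail x z"
    and late: "\<lbrakk>0 < m z (i - 1) \<or> z = i; ?R z + ?B z i < ?K x z\<rbrakk> \<Longrightarrow> 0 < m z i + ?rb x z + tail x z"
    if z: "z \<in> {1..i}" for x z
  proof -
    have zn: "z \<in> {1..n}" using z i by auto
    show "0 \<le> m z i + ?rb x z + tail x z"
      and "\<lbrakk>0 < m z (i - 1) \<or> z = i; ?R z + ?B z i < ?K x z\<rbrakk> \<Longrightarrow> 0 < m z i + ?rb x z + tail x z"
    proof (atomize (full), cases "z = i")
      case False
      then have "z < i" using z by simp
      then have r: "?rb x z = max 0 (min (?K x z) (?R z + ?B z (i - 1)) - (?R z + ?B z i))
         - max 0 (min (?K x z) (?R z + ?B z i) - (?R z + ?B z (i + 1)))" by (rule rb(1)[OF zn])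
      have t: "tail x z = 0" using False by (simp add: tail_def)
      show "0 \<le> m z i + ?rb x z + tail x z \<and>
        (0 < m z (i - 1) \<or> z = i \<longrightarrow> ?R z + ?B z i < ?K x z \<longrightarrow> 0 < m z i + ?rb x z + tail x z)"
        unfolding r t using Bi[of z] mnn[of z i] mnn[of z "i - 1"] False by (auto simp: max_def min_def)
    next
      case True
      then have r: "?rb x z = max 0 (?K x z - (?R z + ?B z i))
         - max 0 (min (?K x z) (?R z + ?B z i) - (?R z + ?B z (i + 1)))" by (rule rb(2)[OF zn])
      have t: "- max 0 (?K x z - (?R z + ?B z i + 1)) \<le> tail x z"
      proof (cases "i < n")
        case lt: True
        have "?rb x (i + 1) = - max 0 (?K x (i + 1) - (?R (i + 1) + ?B (i + 1) (i + 1)))"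
          using lt by (intro rb(3)) auto
        moreover have "?R (i + 1) = ?R z + ?B z i + 1" using row_start_Suc[of i n m] i True by simp
        moreover have "?K x (i + 1) \<le> ?K x z" using True Kmono by simp
        ultimately show ?thesis using lt True Bnn[of "i + 1" "i + 1"] by (auto simp: tail_def max_def)
      qed (simp add: tail_def)
      show "0 \<le> m z i + ?rb x z + tail x z \<and>
        (0 < m z (i - 1) \<or> z = i \<longrightarrow> ?R z + ?B z i < ?K x z \<longrightarrow> 0 < m z i + ?rb x z + tail x z)"
        unfolding r using t Bi[of z] mnn[of z i] by (auto simp: max_def min_def split: if_splits)
    qed
  qed
  have zone: "\<exists>z\<in>{1..i}. (z = 1 \<or> ?R z \<le> ?K x z) \<and> (\<forall>j\<in>{z<..i}. ?K x j < ?R j)" for x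
  proof -
    let ?P = "\<lambda>z. z \<in> {1..i} \<and> (z = 1 \<or> ?R z \<le> ?K x z)"
    define z where "z = (GREATEST z. ?P z)"
    have "?P 1" using i1 by auto
    then have P: "?P z" unfolding z_def by (rule GreatestI_nat[where b = i]) auto
    have "?K x j < ?R j" if "j \<in> {z<..i}" for j
    proof (rule ccontr)
      assume "\<not> ?thesis"
      then have "?P j" using that by auto
      then have "j \<le> z" unfolding z_def by (rule Greatest_le_nat[where b = i]) auto
      then show False using that by simp
    qed
    then show ?thesis using P by blast
  qed
  have at_k0: "balance n i ?T k0 = - height m i a"
  proof -
    have "balance n i ?T k0 = m a i - height m i a + ?rb k0 a + tail k0 a"
    proof (rule formula[OF p(1)])
      show "a = 1 \<or> ?R a \<le> ?K k0 a" using Ka c0 Bnn[of a i] by simp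
      fix j assume j: "a < j" "j \<le> i"
      have "?K k0 j \<le> int c0" using Kmono[of a j k0] j Ka by simp
      also have "\<dots> \<le> ?R a + ?B a a" using c0 boxes_above_antimono[OF m a(2), of a] by simp
      also have "\<dots> < ?R j" using row_start_strict_mono[OF m, of a j] j a by simp
      finally show "?K k0 j \<le> ?R j" by simp
    qed
    moreover have "m a i + ?rb k0 a + tail k0 a \<le> 0"
    proof (cases "a = i")
      case True
      have "tail k0 a \<le> 0"
        using rb(3)[of "i + 1"] by (auto simp: tail_def)
      then show ?thesis using rb(2)[OF a(1) True] Ka c0 Bi[of a] mnn[of a i] by (auto simp: max_def)
    next
      case False
      then have "a < i" using a by simp
      then show ?thesis using rb(1)[OF a(1)] Ka c0 Bi[of a] mnn[of a i] mnn[of a "i - 1"] False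
        by (auto simp: tail_def max_def min_def)
    qed
    ultimately show ?thesis using early[OF p(1), of k0] by linarith
  qed
  have "leftmost_plus ?T i = box_at n k0"
  proof (rule leftmost_plus_last_minimum[OF rows])
    fix x
    obtain z where z: "z \<in> {1..i}" "z = 1 \<or> ?R z \<le> ?K x z" "\<forall>j\<in>{z<..i}. ?K x j < ?R j"
      using zone by blast
    have bx: "balance n i ?T x = m z i - height m i z + ?rb x z + tail x z"
    proof (rule formula[OF z(1,2)])
      show "?K x j \<le> ?R j" if "z < j" "j \<le> i" for j
        using bspec[OF z(3), of j] that by simp
    qed
    show "balance n i ?T k0 \<le> balance n i ?T x"
      using p(2)[OF z(1)] early[OF z(1), of x] unfolding at_k0 bx by linarith
    show "balance n i ?T k0 < balance n i ?T x" if "k0 < x"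
    proof -
      have "columns_read n (Suc k0) a \<le> columns_read n x a"
        unfolding columns_read_def using that by (intro div_le_mono) simp
      then have late_a: "?R a + ?B a i < ?K x a" using Ka c0 by simp
      have "a \<le> z"
      proof (rule ccontr)
        assume "\<not> ?thesis"
        then have "?K x a < ?R a" using z(3) p(1) by simp
        then show False using late_a Bnn[of a i] by linarith
      qed
      show ?thesis
      proof (cases "z = a")
        case True
        have "0 < m a (i - 1) \<or> a = i" using multisegments_f_end(2)[OF m i] a(2) unfolding a_def by linarith
        then show ?thesis using late[OF z(1), of x] late_a True unfolding at_k0 bx by simp
      next
        case False
        then have "height m i z < height m i a" using p(3)[OF z(1)] \<open>a \<le> z\<close> by simp
        then show ?thesis using early[OF z(1), of x] unfolding at_k0 bx by linarith
      qed
    qed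
  qed
  also have "\<dots> = (a, c0)" using a unfolding k0_def by (intro box_at_reading_position) simp
  finally show ?thesis by (simp add: c0_def)
qed

section \<open>Kashiwara operators on tableaux\<close>

lemma boxes_above_lengthen_end:
  assumes "a \<in> {1..i}" "i \<le> n" "j \<le> e"
  shows "boxes_above n (lengthen_end a i m) j e = boxes_above n m j e + (if j = a \<and> e = i then 1 else 0)"
proof -
  have "boxes_above n (lengthen_end a i m) j e
     = (\<Sum>b = e..n. m j b + ((if b = i then (if j = a then 1 else 0) else 0)
          + (if b = i - 1 then (if j = a \<and> a < i then -1 else 0) else 0)))"
    unfolding boxes_above_def by (intro sum.cong) (auto simp: lengthen_end_def)
  then show ?thesis using assms by (simp add: boxes_above_def sum.distrib sum.delta) auto
qed

lemma row_start_lengthen_end: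
  assumes "a \<in> {1..i}" "i \<le> n"
  shows "row_start n (lengthen_end a i m) j = row_start n m j + (if a = i \<and> i < j then 1 else 0)"
proof -
  have "row_start n (lengthen_end a i m) j
     = (\<Sum>k = 1..<j. (boxes_above n m k k + 1) + (if k = i then (if a = i then 1 else 0) else 0))"
    unfolding row_start_def using boxes_above_lengthen_end[OF assms order_refl]
    by (intro sum.cong) auto
  then show ?thesis using assms by (simp add: row_start_def sum.distrib sum.delta)
qed

text \<open>
  A change in row \<open>a < i\<close> takes place within the row. A change in row \<open>i\<close> itself lengthens the part of
  this row under which row \<open>i + 1\<close> must not extend; this is the case in which the tableau is no longer
  marginally large and the rows below are pushed. For \<open>i = n\<close> there is nothing below to be pushed.
\<close>

lemma f_op_tableau_of:
  assumes n: "1 \<le> n" and m: "m \<in> multisegments n" and i: "i \<in> {1..n}"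
  shows "f_op n i (tableau_of n m) = tableau_of n (f_end i m)"
proof -
  let ?R = "row_start n m" and ?B = "boxes_above n m"
  define a where "a = end_row m i"
  define c0 where "c0 = nat (?R a + ?B a i)"
  define m' where "m' = f_end i m"
  define T' where "T' = (tableau_of n m)((a, c0) \<mapsto> i + 1)"
  have a: "a \<in> {1..i}" "a \<in> {1..n}" using end_row_props(1)[of i m] i by (auto simp: a_def)
  have m': "m' \<in> multisegments n" unfolding m'_def by (rule multisegments_f_end(1)[OF m i])
  have m'_eq: "m' = lengthen_end a i m" by (simp add: m'_def f_end_def a_def)
  have R': "row_start n m' j = ?R j + (if a = i \<and> i < j then 1 else 0)" for j
    unfolding m'_eq using a i by (intro row_start_lengthen_end) auto
  have B': "boxes_above n m' j e = ?B j e + (if j = a \<and> e = i then 1 else 0)" if "j \<le> e" for j e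
    unfolding m'_eq using a i that by (intro boxes_above_lengthen_end) auto
  have c0: "int c0 = ?R a + ?B a i"
    using row_start_nonneg[OF m, of a] boxes_above_nonneg[OF m, of a i] by (simp add: c0_def)
  have eqI: "u = v" if "\<And>e. u = Some e \<longleftrightarrow> v = Some e" for u v :: "nat option"
    by (metis not_None_eq that)
  have upper: "T' (j, c) = tableau_of n m' (j, c)" if "\<not> (a = i \<and> i < j)" for j c
  proof (cases "j \<in> {1..n}")
    case j: True
    note eq = tableau_of_eq_Some[OF m j] and eq' = tableau_of_eq_Some[OF m' j]
    have R'j: "row_start n m' j = ?R j" using R' that by simp
    show ?thesis
    proof (rule eqI)
      fix e
      have *: "?B a (i + 1) \<le> ?B a i" using boxes_above_antimono[OF m] by simp
      show "T' (j, c) = Some e \<longleftrightarrow> tableau_of n m' (j, c) = Some e"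
      proof (cases "(j, c) = (a, c0)")
        case True
        have "tableau_of n m' (a, c0) = Some (i + 1)"
          using True a(1) R'j B'[of a i] B'[of a "i + 1"] c0 * by (subst tableau_of_eq_Some[OF m' a(2)]) auto
        then show ?thesis using True by (auto simp: T'_def)
      next
        case False
        have "int c \<noteq> int c0 \<or> j \<noteq> a" using False by auto
        then show ?thesis
          using False B'[of j e] B'[of j "e - 1"] R'j c0 eq[of c e] eq'[of c e]
          by (cases "e = j"; cases "e \<ge> j") (auto simp: T'_def)
      qed
    qed
  next
    case False
    then have "(j, c) \<noteq> (a, c0)" using a by auto
    then show ?thesis using False by (auto simp: T'_def tableau_of_def)
  qed
  have f_op: "f_op n i (tableau_of n m) = (if T' \<in> MLT n then T' else push_below a T')"
    using leftmost_plus_tableau_of[OF m i]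
    by (simp add: f_op_def Let_def T'_def a_def c0_def)
  show ?thesis
  proof (cases "a = i")
    case False
    then have "T' = tableau_of n m'" using upper by (auto simp: fun_eq_iff)
    then show ?thesis using f_op tableau_of_in_MLT[OF m' n] by (simp add: m'_def)
  next
    case ai: True
    have push: "push_below i T' = tableau_of n m'"
    proof (rule ext, clarify)
      fix j c
      show "push_below i T' (j, c) = tableau_of n m' (j, c)"
      proof (cases "i < j")
        case True
        then have ja: "j \<noteq> a" using ai by simp
        show ?thesis
        proof (cases "j \<in> {1..n}")
          case j: True
          have R'j: "row_start n m' j = ?R j + 1" using R' ai True by simp
          show ?thesis
          proof (cases "c = 0")
            case c: True
            then have "tableau_of n m' (j, c) = None"
              using R'j row_start_nonneg[OF m, of j] by (simp add: tableau_of_eq_None)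
            then show ?thesis using True c by (simp add: push_below_def)
          next
            case c: False
            have "tableau_of n m (j, c - 1) = tableau_of n m' (j, c)"
            proof (rule eqI)
              fix e
              have "j \<le> e - 1" if "j \<le> e" "e \<noteq> j" using that by linarith
              then show "tableau_of n m (j, c - 1) = Some e \<longleftrightarrow> tableau_of n m' (j, c) = Some e"
                unfolding tableau_of_eq_Some[OF m j] tableau_of_eq_Some[OF m' j]
                using c ja R'j B'[of j e] B'[of j "e - 1"]
                by (cases "e = j") (auto simp: of_nat_diff)
            qed
            then show ?thesis using True c ja by (simp add: push_below_def T'_def)
          qed
        qed (use True ja in \<open>auto simp: push_below_def T'_def tableau_of_def\<close>)
      qed (use upper in \<open>auto simp: push_below_def\<close>)
    qed
    show ?thesis
    proof (cases "T' \<in> MLT n")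
      case True
      have "i = n"
      proof (rule ccontr)
        assume "i \<noteq> n"
        then have i': "i + 1 \<in> {1..n}" using i by simp
        \<comment> \<open>In an MLT the rightmost \<open>i\<close>-box of row \<open>i < n\<close> has no box
          below it; in \<open>T'\<close> this box has been overwritten, and every other
          \<open>i\<close>-box of the row has one.\<close>
        obtain k where k: "k \<in> multisegments n" "T' = tableau_of n k" using True MLT_eq[OF n] by blast
        define c where "c = nat (row_start n k i + boxes_above n k i i)"
        have c: "int c = row_start n k i + boxes_above n k i i"
          using row_start_nonneg[OF k(1), of i] boxes_above_nonneg[OF k(1), of i i] by (simp add: c_def)
        have 1: "T' (i, c) = Some i" unfolding k(2) using c i by (subst tableau_of_eq_Some[OF k(1)]) auto
        have 2: "T' (i + 1, c) = None" unfolding k(2)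
          using c row_start_Suc[of i n k] i by (simp add: tableau_of_eq_None)
        have "c \<noteq> c0" using 1 ai by (auto simp: T'_def)
        moreover have "tableau_of n m (i, c) = Some i" using 1 \<open>c \<noteq> c0\<close> by (simp add: T'_def)
        then have "int c0 \<le> int c" using c0 ai i by (simp add: tableau_of_eq_Some[OF m])
        moreover have "tableau_of n m (i + 1, c) = None" using 2 ai by (simp add: T'_def)
        then have "int c < ?R (i + 1)" using i' by (simp add: tableau_of_eq_None)
        then have "int c < int c0 + 1" using row_start_Suc[of i n m] c0 ai i by simp
        ultimately show False by simp
      qed
      have "T' (j, c) = push_below i T' (j, c)" for j c
        using \<open>i = n\<close> ai by (auto simp: push_below_def T'_def tableau_of_def)
      then have "T' = push_below i T'" by (auto simp: fun_eq_iff)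
      then show ?thesis using f_op True push by (simp add: m'_def)
    next
      case False
      then show ?thesis using f_op push ai by (simp add: m'_def)
    qed
  qed
qed

lemma fold_f_op_tableau_of:
  assumes "1 \<le> n" "m \<in> multisegments n" "set w \<subseteq> {1..n}"
  shows "fold (f_op n) w (tableau_of n m) = tableau_of n (fold f_end w m) \<and> fold f_end w m \<in> multisegments n"
  using assms(2,3)
  by (induction w arbitrary: m) (simp_all add: f_op_tableau_of[OF assms(1)] multisegments_f_end(1))

text \<open>
  \<open>T_inf\<close> is defined by a definite description; it is determined because the numbers of boxes determine
  an MLT.
\<close>

lemma T_inf_eq:
  assumes n: "1 \<le> n"
  shows "T_inf n = tableau_of n (\<lambda>_ _. 0)"
  unfolding T_inf_def
proof (rule the_equality)
  have nb: "num_boxes (tableau_of n (\<lambda>_ _. 0)) j i = 0" if "1 \<le> j" "j < i" "i \<le> n + 1" for j i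
    using num_boxes_tableau_of[OF zero_multisegments that] by simp
  then show "tableau_of n (\<lambda>_ _. 0) \<in> MLT n \<and>
      (\<forall>j i. 1 \<le> j \<and> j < i \<and> i \<le> n + 1 \<longrightarrow> num_boxes (tableau_of n (\<lambda>_ _. 0)) j i = 0)"
    using tableau_of_in_MLT[OF zero_multisegments n] by blast
  fix T assume T: "T \<in> MLT n \<and> (\<forall>j i. 1 \<le> j \<and> j < i \<and> i \<le> n + 1 \<longrightarrow> num_boxes T j i = 0)"
  then obtain m where m: "m \<in> multisegments n" "T = tableau_of n m" using MLT_eq[OF n] by blast
  have "m a b = 0" for a b
  proof (cases "1 \<le> a \<and> a \<le> b \<and> b \<le> n")
    case True
    then show ?thesis using num_boxes_tableau_of[OF m(1), of a "b + 1"] T m(2) by simp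
  next
    case False
    then show ?thesis using m(1) by (auto simp: multisegments_def)
  qed
  then have "m = (\<lambda>_ _. 0)" by (intro ext)
  then show "T = tableau_of n (\<lambda>_ _. 0)" using m(2) by simp
qed

section \<open>Reversal of entries and the involution\<close>

text \<open>
  Needs entries of at most \<open>n + 2\<close>, since the subtraction on natural numbers truncates.
\<close>

lemma reverse_reverse_entries:
  assumes "1 \<le> n" "T \<in> MLT n"
  shows "reverse_entries n (reverse_entries n T) = T"
proof (rule ext, clarify)
  fix j c
  obtain m where m: "m \<in> multisegments n" "T = tableau_of n m" using MLT_eq assms by blast
  show "reverse_entries n (reverse_entries n T) (j, c) = T (j, c)"
  proof (cases "T (j, c)")
    case (Some e)
    then have "e \<le> n + 1" using tableau_of_le(2)[OF m(1)] m(2) by blast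
    then show ?thesis using Some by (simp add: reverse_entries_def)
  qed (simp add: reverse_entries_def)
qed

lemma eta_inv_eq:
  assumes n: "1 \<le> n" and T: "T \<in> MLT n"
  shows "eta_inv n T = reverse_entries n T"
proof -
  have "inj_on (eta n) (MLT' n)"
    by (rule inj_on_inverseI[where g = "reverse_entries n"])
       (auto simp: MLT'_def eta_def reverse_reverse_entries[OF n])
  moreover have "reverse_entries n T \<in> MLT' n" using T by (simp add: MLT'_def)
  ultimately have "inv_into (MLT' n) (eta n) (eta n (reverse_entries n T)) = reverse_entries n T"
    by (rule inv_into_f_f)
  then show ?thesis by (simp add: eta_inv_def eta_def reverse_reverse_entries[OF n T])
qed

definition complement_word :: "nat \<Rightarrow> nat list \<Rightarrow> nat list" where
  "complement_word n w = map (\<lambda>i. n + 1 - i) w"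

lemma set_complement_word: "set w \<subseteq> {1..n} \<Longrightarrow> set (complement_word n w) \<subseteq> {1..n}"
  by (induction w) (auto simp: complement_word_def)

lemma complement_complement_word: "set w \<subseteq> {1..n} \<Longrightarrow> complement_word n (complement_word n w) = w"
  by (induction w) (auto simp: complement_word_def)

lemma f_op_in_MLT: "1 \<le> n \<Longrightarrow> T \<in> MLT n \<Longrightarrow> i \<in> {1..n} \<Longrightarrow> f_op n i T \<in> MLT n"
  using MLT_eq f_op_tableau_of multisegments_f_end(1) by auto

text \<open>
  On reversed tableaux \<open>f_op' n i\<close> is by definition \<open>f_op n (n + 1 - i)\<close>, so reversing the entries
  before and after makes a word act as the word with complemented letters.
\<close>

lemma fold_f_op'_eq:
  assumes n: "1 \<le> n" and "T \<in> MLT n" "set w \<subseteq> {1..n}"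
  shows "fold (f_op' n) w (reverse_entries n T) = reverse_entries n (fold (f_op n) (complement_word n w) T)"
  using assms(2,3)
proof (induction w arbitrary: T)
  case (Cons i w)
  then have i: "n + 1 - i \<in> {1..n}" by auto
  have "f_op n (n + 1 - i) T \<in> MLT n" by (rule f_op_in_MLT[OF n Cons.prems(1) i])
  moreover from this have "f_op' n i (reverse_entries n T) = reverse_entries n (f_op n (n + 1 - i) T)"
    by (simp add: f_op'_def eta_def reverse_reverse_entries[OF n Cons.prems(1)] eta_inv_eq[OF n])
  ultimately show ?case using Cons by (simp add: complement_word_def)
qed (simp add: complement_word_def)

lemma fold_f_start:
  assumes "m \<in> multisegments n" "set w \<subseteq> {1..n}"
  shows "fold (f_start n) w m = flip n (fold f_end (complement_word n w) (flip n m))"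
  using assms
proof (induction w arbitrary: m)
  case (Cons i w)
  then have i: "n + 1 - i \<in> {1..n}" by auto
  have "flip n (f_start n i m) = f_end (n + 1 - i) (flip n m)"
    unfolding f_start_def by (intro flip_flip multisegments_f_end(1) flip_multisegments Cons.prems(1) i)
  then show ?case
    using Cons.IH[OF f_start_multisegments[OF Cons.prems(1)], of i] Cons.prems(2)
    by (simp add: complement_word_def)
qed (simp add: complement_word_def flip_flip)

lemma dual_fold: "dual n m m' \<Longrightarrow> set w \<subseteq> {1..n} \<Longrightarrow> dual n (fold f_end w m) (fold (f_start n) w m')"
proof (induction w arbitrary: m m')
  case (Cons i w)
  then show ?case using Cons.IH[OF dual.f_end[OF Cons.prems(1), of i]] by simp
qed simp

text \<open>
  Translated to multisegments, complementing the letters of a word amounts to replacing \<open>f_end\<close> by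
  \<open>f_start\<close>, up to the bijection \<open>flip\<close>. Both words thus yield a partner of the same multisegment under
  \<open>dual\<close>, and partners are unique.
\<close>

lemma complement_word_well_defined:
  assumes n: "1 \<le> n" and w: "set w \<subseteq> {1..n}" "set w' \<subseteq> {1..n}"
    and eq: "fold (f_op n) w (T_inf n) = fold (f_op n) w' (T_inf n)"
  shows "fold (f_op n) (complement_word n w) (T_inf n) = fold (f_op n) (complement_word n w') (T_inf n)"
proof -
  let ?z = "(\<lambda>_ _. 0) :: multisegment"
  note z = zero_multisegments[of n]
  note F = fold_f_op_tableau_of[OF n z]
  have flip0: "flip n ?z = ?z" by (simp add: flip_def)
  have "fold f_end w ?z = fold f_end w' ?z"
    using eq F[OF w(1)] F[OF w(2)] inj_onD[OF tableau_of_inj] by (simp add: T_inf_eq[OF n])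
  then have "fold (f_start n) w ?z = fold (f_start n) w' ?z"
    using dual_fold[OF dual.empty w(1)] dual_fold[OF dual.empty w(2)] dual_unique by simp
  then have "flip n (fold f_end (complement_word n w) ?z) = flip n (fold f_end (complement_word n w') ?z)"
    using fold_f_start[OF z w(1)] fold_f_start[OF z w(2)] by (simp add: flip0)
  then have "fold f_end (complement_word n w) ?z = fold f_end (complement_word n w') ?z"
    using F[OF set_complement_word[OF w(1)]] F[OF set_complement_word[OF w(2)]] flip_flip by metis
  then show ?thesis
    using F[OF set_complement_word[OF w(1)]] F[OF set_complement_word[OF w(2)]] by (simp add: T_inf_eq[OF n])
qed

lemma MLT_generated:
  assumes n: "1 \<le> n" and "X \<in> MLT n"
  obtains w where "set w \<subseteq> {1..n}" "X = fold (f_op n) w (T_inf n)"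
proof -
  obtain m where m: "m \<in> multisegments n" "X = tableau_of n m" using MLT_eq[OF n] assms(2) by blast
  from m(1) have "\<exists>w. set w \<subseteq> {1..n} \<and> m = fold f_end w (\<lambda>_ _. 0)"
  proof (induction rule: multisegments_induct)
    case empty
    show ?case by (intro exI[of _ "[]"]) simp
  next
    case (f_end i k)
    then obtain w where "set w \<subseteq> {1..n}" "k = fold f_end w (\<lambda>_ _. 0)" by blast
    then show ?case using f_end(1) by (intro exI[of _ "w @ [i]"]) simp
  qed
  then show ?thesis
    using that fold_f_op_tableau_of[OF n zero_multisegments] m(2) T_inf_eq[OF n] by metis
qed

lemma fold_f_op_in_MLT:
  assumes "1 \<le> n" "set w \<subseteq> {1..n}"
  shows "fold (f_op n) w (T_inf n) \<in> MLT n"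
  using fold_f_op_tableau_of[OF assms(1) zero_multisegments assms(2)] tableau_of_in_MLT[OF _ assms(1)]
  by (simp add: T_inf_eq[OF assms(1)])

lemma rho_fold:
  assumes n: "1 \<le> n" and w: "set w \<subseteq> {1..n}"
  shows "rho n (fold (f_op n) w (T_inf n)) = fold (f_op n) (complement_word n w) (T_inf n)"
proof -
  have image: "eta n (fold (f_op' n) v (eta_inv n (T_inf n))) = fold (f_op n) (complement_word n v) (T_inf n)"
    if v: "set v \<subseteq> {1..n}" for v
  proof -
    have "T_inf n \<in> MLT n" using fold_f_op_in_MLT[OF n, of "[]"] by simp
    then show ?thesis
      using fold_f_op_in_MLT[OF n set_complement_word[OF v]]
      by (simp add: eta_inv_eq[OF n] fold_f_op'_eq[OF n _ v] eta_def reverse_reverse_entries[OF n])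
  qed
  show ?thesis
    unfolding rho_def
  proof (rule the_equality)
    show "\<exists>v. set v \<subseteq> {1..n} \<and> fold (f_op n) w (T_inf n) = fold (f_op n) v (T_inf n) \<and>
        fold (f_op n) (complement_word n w) (T_inf n) = eta n (fold (f_op' n) v (eta_inv n (T_inf n)))"
      using w image[OF w] by metis
    fix Z
    assume "\<exists>v. set v \<subseteq> {1..n} \<and> fold (f_op n) w (T_inf n) = fold (f_op n) v (T_inf n) \<and>
        Z = eta n (fold (f_op' n) v (eta_inv n (T_inf n)))"
    then show "Z = fold (f_op n) (complement_word n w) (T_inf n)"
      using image complement_word_well_defined[OF n w] by metis
  qed
qed

theorem proposition2p8:
  fixes n :: nat
  assumes "1 \<le> n"
  shows "(\<forall>w. set w \<subseteq> {1..n} \<longrightarrow>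
            rho n (fold (f_op n) w (T_inf n)) = fold (f_op n) (map (\<lambda>i. n + 1 - i) w) (T_inf n)) \<and>
         rho n ` MLT n \<subseteq> MLT n \<and>
         (\<forall>X\<in>MLT n. rho n (rho n X) = X)"
proof (intro conjI allI impI ballI subsetI)
  show "rho n (fold (f_op n) w (T_inf n)) = fold (f_op n) (map (\<lambda>i. n + 1 - i) w) (T_inf n)"
    if "set w \<subseteq> {1..n}" for w
    using rho_fold[OF assms that] by (simp add: complement_word_def)
  show "Y \<in> MLT n" if "Y \<in> rho n ` MLT n" for Y
    using that MLT_generated[OF assms] rho_fold[OF assms] set_complement_word fold_f_op_in_MLT[OF assms]
    by (metis imageE)
  show "rho n (rho n X) = X" if X: "X \<in> MLT n" for X
  proof -
    obtain w where w: "set w \<subseteq> {1..n}" "X = fold (f_op n) w (T_inf n)" using MLT_generated[OF assms X] .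
    then show ?thesis
      using rho_fold[OF assms set_complement_word[OF w(1)]] rho_fold[OF assms w(1)] complement_complement_word[OF w(1)]
      by simp
  qed
qed

end
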